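(* Let $d\ge 1$, let $\mathcal L\subset\mathbb R^d$ be a nonempty discrete (i.e. locally finite) set which is periodic with period $1$ in the coordinate directions, i.e. $\mathcal L+e_i=\mathcal L$ for all $i\in\{1,\dots,d\}$, where $e_1,\dots,e_d$ is the canonical basis of $\mathbb R^d$. Let $\eta=\eta_\varepsilon>0$ (for $\varepsilon>0$) satisfy $$\lim_{\varepsilon\to0}\eta_\varepsilon=\lim_{\varepsilon\to 0}\frac{\varepsilon}{\eta_\varepsilon}=0.$$ For $u:\varepsilon\mathcal L\to\{0,1\}$, writing $u_i=u(\varepsilon i)$ for $i\in\mathcal L$, define $$E_\varepsilon(u)=\frac{\varepsilon^{2d}}{\eta_\varepsilon^{d+1}}\sum_{\substack{i,j\in\mathcal L\\ i-j\in Q_{\eta_\varepsilon/\varepsilon}}}|u_i-u_j|,$$ where $Q_R=[-R/2,R/2)^d$ and the sum is over ordered pairs $(i,j)$. Let $u^\varepsilon:\varepsilon\mathcal L\to\{0,1\}$ be functions such that $E_\varepsilon(u^\varepsilon)$ is equibounded, i.e. $\sup_\varepsilon E_\varepsilon(u^\varepsilon)<+\infty$. Then, up to subsequences (that is, from every sequence $\varepsilon_n\to0$ one can extract a subsequence along which the following holds), the piecewise-constant interpolations of $u^\varepsilon$ converge in $L^1_{\rm loc}(\mathbb R^d)$ to $\chi_A$, the characteristic function of a set $A\subset\mathbb R^d$ of finite perimeter.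
   Context: For $i\in\mathcal L$ the Voronoi cell is $V_i=\{x\in\mathbb R^d: |x-i|<|x-j|\text{ for all }j\in\mathcal L,\ j\ne i\}$. The piecewise-constant interpolation of $u:\varepsilon\mathcal L\to\{0,1\}$ is the $L^\infty(\mathbb R^d)$ function (defined almost everywhere) equal to $u(\varepsilon i)$ on $\varepsilon V_i$ for each $i\in\mathcal L$. A set of finite perimeter is a measurable set $A\subset\mathbb R^d$ whose characteristic function has distributional derivative equal to a finite Radon measure on $\mathbb R^d$ (the Lebesgue measure of $A$ itself may be infinite). *)

theory Defs
  imports "HOL-Analysis.Analysis"
begin

definition locally_finite :: "('a::metric_space) set \<Rightarrow> bool" where
  "locally_finite L \<longleftrightarrow> (\<forall>B. bounded B \<longrightarrow> finite (L \<inter> B))"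

definition unit_periodic :: "(real^'d) set \<Rightarrow> bool" where
  "unit_periodic L \<longleftrightarrow> (\<forall>k. (\<lambda>x. x + axis k 1) ` L = L)"

definition half_open_cube :: "real \<Rightarrow> (real^'d) set" where
  "half_open_cube R = {x. \<forall>k. - R / 2 \<le> x $ k \<and> x $ k < R / 2}"

text \<open>The sum has infinitely many terms in general. It is taken in the extended nonnegative reals,
  where it always exists and may be infinite.\<close>

definition energy :: "(real^'d) set \<Rightarrow> (real \<Rightarrow> real) \<Rightarrow> real \<Rightarrow> (real^'d \<Rightarrow> real) \<Rightarrow> ennreal" where
  "energy L \<eta> \<epsilon> u =
     ennreal (\<epsilon> ^ (2 * CARD('d)) / \<eta> \<epsilon> ^ (CARD('d) + 1)) *
     (\<Sum>\<^sub>\<infinity>(i, j) \<in> {(i, j). i \<in> L \<and> j \<in> L \<and> i - j \<in> half_open_cube (\<eta> \<epsilon> / \<epsilon>)}.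
        ennreal \<bar>u (\<epsilon> *\<^sub>R i) - u (\<epsilon> *\<^sub>R j)\<bar>)"

definition voronoi_cell :: "(real^'d) set \<Rightarrow> real^'d \<Rightarrow> (real^'d) set" where
  "voronoi_cell L i = {x. \<forall>j\<in>L. j \<noteq> i \<longrightarrow> norm (x - i) < norm (x - j)}"

text \<open>The piecewise-constant interpolation is only determined almost everywhere. The value 0 outside
  the scaled cells is an arbitrary choice of representative.\<close>

definition interpolation ::
    "(real^'d) set \<Rightarrow> real \<Rightarrow> (real^'d \<Rightarrow> real) \<Rightarrow> real^'d \<Rightarrow> real" where
  "interpolation L \<epsilon> u x =
     (if \<exists>i\<in>L. x \<in> scaleR \<epsilon> ` voronoi_cell L i
      then u (\<epsilon> *\<^sub>R (THE i. i \<in> L \<and> x \<in> scaleR \<epsilon> ` voronoi_cell L i))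
      else 0)"

lemma voronoi_cell_unique:
  assumes "i \<in> L" "j \<in> L" "x \<in> voronoi_cell L i" "x \<in> voronoi_cell L j"
  shows "i = j"
  using assms unfolding voronoi_cell_def by force

lemma interpolation_eq:
  assumes "\<epsilon> > 0" "i \<in> L" "x \<in> scaleR \<epsilon> ` voronoi_cell L i"
  shows "interpolation L \<epsilon> u x = u (\<epsilon> *\<^sub>R i)"
proof -
  have "j = i" if "j \<in> L" "x \<in> scaleR \<epsilon> ` voronoi_cell L j" for j
    using that assms voronoi_cell_unique[of j L i] by auto
  then have "(THE i. i \<in> L \<and> x \<in> scaleR \<epsilon> ` voronoi_cell L i) = i"
    using assms by blast
  then show ?thesis
    using assms unfolding interpolation_def by auto
qed

definition L1_loc :: "('a::euclidean_space \<Rightarrow> real) \<Rightarrow> bool" where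
  "L1_loc f \<longleftrightarrow> (\<forall>K. compact K \<longrightarrow> set_integrable lebesgue K f)"

definition converges_L1_loc ::
    "(nat \<Rightarrow> 'a::euclidean_space \<Rightarrow> real) \<Rightarrow> ('a \<Rightarrow> real) \<Rightarrow> bool" where
  "converges_L1_loc f g \<longleftrightarrow>
     (\<forall>n. L1_loc (f n)) \<and> L1_loc g \<and>
     (\<forall>K. compact K \<longrightarrow> (\<lambda>n. LINT x:K|lebesgue. \<bar>f n x - g x\<bar>) \<longlonglongrightarrow> 0)"

definition partial_deriv :: "'d \<Rightarrow> (real^'d \<Rightarrow> real) \<Rightarrow> real^'d \<Rightarrow> real" where
  "partial_deriv k f x = deriv (\<lambda>t. f (x + t *\<^sub>R axis k 1)) 0"

text \<open>Differentiability of all iterated partial derivatives makes each of them continuous,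
  so the functions below are exactly those of class \<open>C\<^sub>c\<^sup>\<infinity>\<close>.\<close>

definition test_function :: "(real^'d \<Rightarrow> real) \<Rightarrow> bool" where
  "test_function \<phi> \<longleftrightarrow>
     (\<forall>ks x. foldr partial_deriv ks \<phi> differentiable (at x)) \<and>
     compact (closure {x. \<phi> x \<noteq> 0})"

text \<open>A finite vector-valued Radon measure is given by its components, and each component, a finite
  signed measure, as the difference \<open>\<mu> k - \<nu> k\<close> of two finite positive Borel measures (Jordan
  decomposition). Finite Borel measures on \<open>real^'d\<close> are automatically Radon.\<close>

definition finite_perimeter :: "(real^'d) set \<Rightarrow> bool" where
  "finite_perimeter A \<longleftrightarrow>
     A \<in> sets lebesgue \<and>
     (\<exists>\<mu> \<nu> :: 'd \<Rightarrow> (real^'d) measure.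
        (\<forall>k. finite_measure (\<mu> k) \<and> sets (\<mu> k) = sets borel \<and>
             finite_measure (\<nu> k) \<and> sets (\<nu> k) = sets borel) \<and>
        (\<forall>k \<phi>. test_function \<phi> \<longrightarrow>
           (LINT x:A|lebesgue. partial_deriv k \<phi> x) =
             - ((LINT x|\<mu> k. \<phi> x) - (LINT x|\<nu> k. \<phi> x))))"

end

theory Submission
  imports Defs "HOL-Probability.Helly_Selection" "HOL-Probability.Giry_Monad" "HOL-Complex_Analysis.Great_Picard"
begin

text \<open>
  Write \<open>T\<^sub>f(h)\<close> for the \<open>L\<^sup>1\<close> norm of \<open>f(\<cdot> + h) - f\<close> and \<open>v\<close> for the interpolation of
  \<open>u \<epsilon>\<close>. The whole argument rests on one estimate, \<open>T\<^sub>v(h) \<le> K (\<bar>h\<bar> + \<eta> \<epsilon> / 8)\<close> for small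
  \<open>\<epsilon>\<close>, with \<open>K\<close> independent of \<open>\<epsilon>\<close> and \<open>h\<close> (\<open>translation_gap_interpolation_le\<close>).

  Since the lattice is periodic, Voronoi cells have bounded diameter, so that
  two points at distance at most \<open>\<eta> \<epsilon> / 4\<close> lie in cells of lattice points that interact in the
  energy once \<open>\<epsilon> / \<eta> \<epsilon>\<close> is small. Hence the energy bounds the integral of \<open>T\<^sub>v\<close> over the ball of
  radius \<open>\<eta> \<epsilon> / 4\<close>. The function \<open>T\<^sub>v\<close> is even and subadditive, which turns this mean bound into
  the pointwise bound \<open>T\<^sub>v(h) \<le> const * \<eta> \<epsilon>\<close> for \<open>\<bar>h\<bar> \<le> \<eta> \<epsilon> / 8\<close>; a general \<open>h\<close> is a sum of such
  short vectors.

  Sets with \<open>T(h) \<le> K (\<bar>h\<bar> + e\<^sub>n)\<close> and \<open>e\<^sub>n \<longlonglongrightarrow> 0\<close> are precompact in \<open>L\<^sup>1\<^sub>l\<^sub>o\<^sub>c\<close>, by a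
  Frechet-Kolmogorov argument (\<open>translation_gap_compact\<close>): averages over the cells of a cubic grid
  are uniformly close to the functions, and there are only countably many of them, so that a diagonal
  subsequence of all averages converges. By Fatou's lemma the limit set \<open>A\<close> satisfies
  \<open>T(h) \<le> K \<bar>h\<bar>\<close>.

  This linear bound says that the difference quotients of the indicator of \<open>A\<close> are bounded in
  \<open>L\<^sup>1\<close>. Their positive and negative parts are densities of measures of bounded mass, and vague limits
  of these measures give the distributional derivative (\<open>finite_perimeter_if_translation_gap_linear\<close>).
  The vague compactness of measures on a Euclidean space (\<open>finite_measure_vague_compact\<close>) is reduced
  to Helly's theorem on the line by means of a space-filling curve that has a Borel right inverse:
  measures are transported to the line by the inverse, and their weak limits are transported back by
  the continuous curve.
\<close>


section \<open>The size of translation differences\<close>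

lemma nn_integral_lborel_translate:
  fixes f :: "'a::euclidean_space \<Rightarrow> ennreal"
  assumes [measurable]: "f \<in> borel_measurable borel"
  shows "(\<integral>\<^sup>+x. f (x + h) \<partial>lborel) = (\<integral>\<^sup>+x. f x \<partial>lborel)"
proof -
  have "(\<integral>\<^sup>+x. f x \<partial>lborel) = (\<integral>\<^sup>+x. f x \<partial>distr lborel borel ((+) h))"
    by (simp add: lborel_distr_plus)
  also have "\<dots> = (\<integral>\<^sup>+x. f (x + h) \<partial>lborel)"
    by (subst nn_integral_distr) (auto simp: add.commute)
  finally show ?thesis by simp
qed

lemma AE_lborel_translate:
  fixes h :: "'a::euclidean_space"
  assumes "AE x in lborel. P x"
  shows "AE x in lborel. P (x + h)"
proof -
  have "AE x in distr lborel borel ((+) h). P x"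
    using assms unfolding lborel_distr_plus[of h] .
  then have "AE x in lborel. P (h + x)"
    by (rule AE_distrD[rotated]) simp
  then show ?thesis by (simp add: add.commute)
qed

text \<open>The value is an extended nonnegative real because the difference need not be integrable
  before a bound has been proved.\<close>

definition translation_gap :: "('a::euclidean_space \<Rightarrow> real) \<Rightarrow> 'a \<Rightarrow> ennreal" where
  "translation_gap f h = (\<integral>\<^sup>+x. ennreal \<bar>f (x + h) - f x\<bar> \<partial>lborel)"

lemma measurable_translation_gap [measurable]:
  fixes f :: "'a::euclidean_space \<Rightarrow> real"
  assumes [measurable]: "f \<in> borel_measurable borel"
  shows "translation_gap f \<in> borel_measurable borel"
proof -
  have "(\<lambda>h. \<integral>\<^sup>+x. ennreal \<bar>f (x + h) - f x\<bar> \<partial>lborel) \<in> borel_measurable lborel"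
    by (rule lborel.borel_measurable_nn_integral) measurable
  then show ?thesis
    unfolding translation_gap_def[abs_def] by simp
qed

lemma translation_gap_zero [simp]: "translation_gap f 0 = 0"
  by (simp add: translation_gap_def)

lemma translation_gap_add:
  assumes [measurable]: "f \<in> borel_measurable borel"
  shows "translation_gap f (h + k) \<le> translation_gap f h + translation_gap f k"
proof -
  have "translation_gap f (h + k) \<le>
      (\<integral>\<^sup>+x. ennreal \<bar>f ((x + h) + k) - f (x + h)\<bar> + ennreal \<bar>f (x + h) - f x\<bar> \<partial>lborel)"
    unfolding translation_gap_def
    by (intro nn_integral_mono) (simp add: add.assoc flip: ennreal_plus)
  also have "\<dots> = (\<integral>\<^sup>+x. ennreal \<bar>f ((x + h) + k) - f (x + h)\<bar> \<partial>lborel) + translation_gap f h"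
    unfolding translation_gap_def by (subst nn_integral_add) auto
  also have "(\<integral>\<^sup>+x. ennreal \<bar>f ((x + h) + k) - f (x + h)\<bar> \<partial>lborel) = translation_gap f k"
    unfolding translation_gap_def
    by (subst nn_integral_lborel_translate[of "\<lambda>x. ennreal \<bar>f (x + k) - f x\<bar>" h]) auto
  finally show ?thesis by (simp add: add.commute)
qed

lemma translation_gap_minus:
  assumes [measurable]: "f \<in> borel_measurable borel"
  shows "translation_gap f (- h) = translation_gap f h"
  using nn_integral_lborel_translate[of "\<lambda>x. ennreal \<bar>f (x - h) - f x\<bar>" h]
  unfolding translation_gap_def by (simp add: abs_minus_commute)

lemma translation_gap_scaleR_nat:
  assumes "f \<in> borel_measurable borel"
  shows "translation_gap f (real n *\<^sub>R h) \<le> of_nat n * translation_gap f h"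
proof (induction n)
  case (Suc n)
  have "translation_gap f (real (Suc n) *\<^sub>R h) = translation_gap f (h + real n *\<^sub>R h)"
    by (simp add: algebra_simps)
  also have "\<dots> \<le> translation_gap f h + of_nat n * translation_gap f h"
    by (rule order_trans[OF translation_gap_add[OF assms] add_left_mono[OF Suc]])
  finally show ?case by (simp add: algebra_simps)
qed auto

text \<open>As \<open>T\<close> is subadditive and even, \<open>T(h) \<le> T(h + y) + T(y)\<close> for \<open>T = translation_gap f\<close> and
  every \<open>y\<close>; averaging over the small ball of \<open>y\<close> turns a bound in the mean into a
  bound for each \<open>h\<close>.\<close>

lemma translation_gap_le_mean:
  fixes f :: "'a::euclidean_space \<Rightarrow> real"
  assumes [measurable]: "f \<in> borel_measurable borel" and h: "norm h \<le> r"
  shows "emeasure lborel (cball (0::'a) r) * translation_gap f h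
           \<le> 2 * (\<integral>\<^sup>+y\<in>cball 0 (2 * r). translation_gap f y \<partial>lborel)"
proof -
  let ?T = "translation_gap f" and ?I = "\<lambda>y. indicator (cball (0::'a) (2*r)) y :: ennreal"
  have I: "(\<lambda>y. ?T y * ?I y) \<in> borel_measurable borel"
    by (intro borel_measurable_times_ennreal measurable_translation_gap borel_measurable_indicator assms(1)) simp
  have I': "(\<lambda>y. ?T (y + h) * ?I (y + h)) \<in> borel_measurable borel"
    by (rule measurable_compose[OF _ I, of "\<lambda>y. y + h"]) simp
  have r: "0 \<le> r" using h norm_ge_zero[of h] by linarith
  have le: "?T h \<le> ?T (h + y) + ?T y" for y
    using translation_gap_add[of f "h + y" "- y"] by (simp add: translation_gap_minus assms(1))
  have "emeasure lborel (cball (0::'a) r) * ?T h = (\<integral>\<^sup>+y. ?T h * indicator (cball (0::'a) r) y \<partial>lborel)"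
    by (subst nn_integral_cmult_indicator) (simp_all add: mult.commute)
  also have "\<dots> \<le> (\<integral>\<^sup>+y. ?T (y + h) * ?I (y + h) + ?T y * ?I y \<partial>lborel)"
  proof (rule nn_integral_mono)
    fix y
    show "?T h * indicator (cball 0 r) y \<le> ?T (y + h) * ?I (y + h) + ?T y * ?I y"
    proof (cases "y \<in> cball 0 r")
      case True
      then have "norm y \<le> r" by simp
      moreover have "norm (y + h) \<le> norm y + norm h"
        by (rule norm_triangle_ineq)
      ultimately have "norm y \<le> 2 * r" "norm (y + h) \<le> 2 * r"
        using r h by linarith+
      then show ?thesis using True le[of y] unfolding add.commute[of h y] by simp
    qed (simp add: indicator_def)
  qed
  also have "\<dots> = (\<integral>\<^sup>+y. ?T (y + h) * ?I (y + h) \<partial>lborel) + (\<integral>\<^sup>+y. ?T y * ?I y \<partial>lborel)"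
    by (rule nn_integral_add) (use I I' in simp_all)
  also have "(\<integral>\<^sup>+y. ?T (y + h) * ?I (y + h) \<partial>lborel) = (\<integral>\<^sup>+y. ?T y * ?I y \<partial>lborel)"
    by (rule nn_integral_lborel_translate[OF I])
  finally show ?thesis unfolding mult_2 .
qed

text \<open>An arbitrary \<open>h\<close> is reached by \<open>\<lceil>\<bar>h\<bar> / r\<rceil>\<close> steps of length at most \<open>r\<close>.\<close>

lemma translation_gap_linear:
  fixes f :: "'a::euclidean_space \<Rightarrow> real"
  assumes f: "f \<in> borel_measurable borel" and r: "r > 0" and K: "K \<ge> 0"
    and small: "\<And>h. norm h \<le> r \<Longrightarrow> translation_gap f h \<le> ennreal (K * r)"
  shows "translation_gap f h \<le> ennreal (K * (norm h + r))"
proof (cases "h = 0")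
  case False
  define n where "n = nat \<lceil>norm h / r\<rceil>"
  have pos: "norm h / r > 0" using False r by simp
  have n1: "norm h / r \<le> real n" and n2: "real n \<le> norm h / r + 1"
    using pos unfolding n_def by linarith+
  have n0: "real n > 0" using n1 pos by linarith
  have "norm ((1 / real n) *\<^sub>R h) \<le> r"
    using n1 n0 r by (simp add: field_simps)
  then have "translation_gap f ((1 / real n) *\<^sub>R h) \<le> ennreal (K * r)" by (rule small)
  then have "of_nat n * translation_gap f ((1 / real n) *\<^sub>R h) \<le> of_nat n * ennreal (K * r)"
    by (rule mult_left_mono) simp
  also have "\<dots> = ennreal (real n * (K * r))"
    using K r by (simp add: ennreal_mult ennreal_of_nat_eq_real_of_nat)
  also have "\<dots> \<le> ennreal (K * (norm h + r))"
  proof (rule ennreal_leI)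
    have "real n * r \<le> (norm h / r + 1) * r" using n2 r by (intro mult_right_mono) auto
    also have "\<dots> = norm h + r" using r by (simp add: field_simps)
    finally show "real n * (K * r) \<le> K * (norm h + r)"
      using mult_left_mono[of "real n * r" "norm h + r" K] K by (simp add: mult.left_commute)
  qed
  finally show ?thesis
    using translation_gap_scaleR_nat[OF f, of n "(1 / real n) *\<^sub>R h"] n0 by simp
qed simp

section \<open>Averages over the cells of a cubic grid\<close>

text \<open>The half-open cube of side \<open>1 / (m + 1)\<close> that contains \<open>x\<close>, as a fibre of the map that takes
  the integer parts of the scaled coordinates. In this form it is evident that the cells partition
  the space, that there are countably many, and that they depend measurably on \<open>x\<close>.\<close>

definition grid_cell :: "nat \<Rightarrow> 'a::euclidean_space \<Rightarrow> 'a set" where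
  "grid_cell m x = {y. \<forall>b\<in>Basis. \<lfloor>real (Suc m) * (y \<bullet> b)\<rfloor> = \<lfloor>real (Suc m) * (x \<bullet> b)\<rfloor>}"

lemma pred_grid_cell [measurable]:
  "(\<lambda>(x, y). y \<in> grid_cell m x) \<in> measurable (borel \<Otimes>\<^sub>M borel) (count_space UNIV)"
  unfolding grid_cell_def mem_Collect_eq by measurable

lemma sets_grid_cell [measurable]: "grid_cell m x \<in> sets borel"
  unfolding grid_cell_def by measurable

lemma countable_range_grid_cell: "countable (range (grid_cell m :: 'a::euclidean_space \<Rightarrow> _))"
proof -
  let ?c = "\<lambda>x::'a. restrict (\<lambda>b. \<lfloor>real (Suc m) * (x \<bullet> b)\<rfloor>) Basis"
  let ?F = "\<lambda>z. {y::'a. \<forall>b\<in>Basis. \<lfloor>real (Suc m) * (y \<bullet> b)\<rfloor> = z b}"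
  have "range (grid_cell m :: 'a \<Rightarrow> _) \<subseteq> ?F ` (\<Pi>\<^sub>E b\<in>Basis. (UNIV :: int set))"
  proof (rule image_subsetI)
    fix x :: 'a
    have "grid_cell m x = ?F (?c x)" by (simp add: grid_cell_def)
    moreover have "?c x \<in> (\<Pi>\<^sub>E b\<in>Basis. (UNIV :: int set))" by simp
    ultimately show "grid_cell m x \<in> ?F ` (\<Pi>\<^sub>E b\<in>Basis. (UNIV :: int set))" by (rule image_eqI)
  qed
  moreover have "countable (?F ` (\<Pi>\<^sub>E b\<in>(Basis :: 'a set). (UNIV :: int set)))"
    by (intro countable_image countable_PiE) auto
  ultimately show ?thesis by (rule countable_subset)
qed

lemma grid_cell_diameter:
  fixes x y :: "'a::euclidean_space"
  assumes "y \<in> grid_cell m x"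
  shows "norm (y - x) \<le> DIM('a) / real (Suc m)"
proof -
  have "\<bar>(y - x) \<bullet> b\<bar> \<le> 1 / real (Suc m)" if "b \<in> Basis" for b
  proof -
    have "\<lfloor>real (Suc m) * (y \<bullet> b)\<rfloor> = \<lfloor>real (Suc m) * (x \<bullet> b)\<rfloor>"
      using assms that by (auto simp: grid_cell_def)
    then have "\<bar>real (Suc m) * (y \<bullet> b) - real (Suc m) * (x \<bullet> b)\<bar> \<le> 1" by linarith
    then have "real (Suc m) * \<bar>(y - x) \<bullet> b\<bar> \<le> 1"
      by (simp add: inner_diff_left abs_mult flip: right_diff_distrib)
    then show ?thesis by (simp add: field_simps)
  qed
  then have "(\<Sum>b\<in>Basis. \<bar>(y - x) \<bullet> b\<bar>) \<le> (\<Sum>b\<in>(Basis::'a set). 1 / real (Suc m))"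
    by (rule sum_mono)
  then show ?thesis using norm_le_l1[of "y - x"] by simp
qed

lemma bounded_grid_cell: "bounded (grid_cell m (x::'a::euclidean_space))"
proof (rule bounded_subset[OF bounded_cball])
  show "grid_cell m x \<subseteq> cball x (DIM('a) / real (Suc m))"
    using grid_cell_diameter by (fastforce simp: dist_norm norm_minus_commute)
qed

lemma emeasure_grid_cell_finite: "emeasure lborel (grid_cell m (x::'a::euclidean_space)) < \<infinity>"
  by (rule emeasure_bounded_finite[OF bounded_grid_cell])

lemma measure_grid_cell_ge:
  "(1 / real (Suc m)) ^ DIM('a) \<le> measure lborel (grid_cell m (x::'a::euclidean_space))"
proof -
  define k where "k = real (Suc m)"
  have k: "k > 0" by (simp add: k_def)
  define l where "l = (\<Sum>b\<in>Basis. (of_int \<lfloor>k * (x \<bullet> b)\<rfloor> / k) *\<^sub>R b)"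
  define u where "u = (\<Sum>b\<in>Basis. ((of_int \<lfloor>k * (x \<bullet> b)\<rfloor> + 1) / k) *\<^sub>R b)"
  have lu: "u \<bullet> b - l \<bullet> b = 1 / k" if "b \<in> Basis" for b
    using that by (simp add: l_def u_def add_divide_distrib)
  have "box l u \<subseteq> grid_cell m x"
  proof
    fix y assume y: "y \<in> box l u"
    have "\<lfloor>k * (y \<bullet> b)\<rfloor> = \<lfloor>k * (x \<bullet> b)\<rfloor>" if b: "b \<in> Basis" for b
    proof -
      have "l \<bullet> b < y \<bullet> b" "y \<bullet> b < u \<bullet> b" using y b by (auto simp: box_def)
      then have "of_int \<lfloor>k * (x \<bullet> b)\<rfloor> < k * (y \<bullet> b)" "k * (y \<bullet> b) < of_int \<lfloor>k * (x \<bullet> b)\<rfloor> + 1"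
        using b k by (simp_all add: l_def u_def field_simps)
      then show ?thesis by linarith
    qed
    then show "y \<in> grid_cell m x" by (simp add: grid_cell_def k_def)
  qed
  then have "measure lborel (box l u) \<le> measure lborel (grid_cell m x)"
    using emeasure_grid_cell_finite[of m x]
    by (intro measure_mono_fmeasurable) (auto simp: fmeasurable_def)
  moreover have "measure lborel (box l u) = (\<Prod>b\<in>(Basis::'a set). 1 / k)"
  proof -
    have "l \<bullet> b \<le> u \<bullet> b" if "b \<in> Basis" for b
    proof -
      have "1 / k > 0" using k by simp
      then show ?thesis using lu[OF that] by linarith
    qed
    then have "measure lborel (box l u) = (\<Prod>b\<in>Basis. (u - l) \<bullet> b)"
      by (simp add: measure_lborel_box_eq)
    also have "\<dots> = (\<Prod>b\<in>(Basis::'a set). 1 / k)"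
      using lu by (intro prod.cong) (auto simp: inner_diff_left)
    finally show ?thesis .
  qed
  ultimately show ?thesis by (simp add: k_def)
qed

definition grid_average :: "nat \<Rightarrow> 'a::euclidean_space set \<Rightarrow> 'a \<Rightarrow> real" where
  "grid_average m E x = measure lborel (E \<inter> grid_cell m x) / measure lborel (grid_cell m x)"

lemma measurable_grid_average [measurable]:
  assumes [measurable]: "E \<in> sets (borel :: 'a::euclidean_space measure)"
  shows "grid_average m E \<in> borel_measurable borel"
proof -
  have eq: "measure lborel (B \<inter> grid_cell m x) =
      enn2real (\<integral>\<^sup>+y. (if y \<in> B \<and> y \<in> grid_cell m x then 1 else 0) \<partial>lborel)"
    if [measurable]: "B \<in> sets borel" for B and x :: 'a
  proof -
    have "emeasure lborel (B \<inter> grid_cell m x) = (\<integral>\<^sup>+y. indicator (B \<inter> grid_cell m x) y \<partial>lborel)"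
      by simp
    also have "\<dots> = (\<integral>\<^sup>+y. (if y \<in> B \<and> y \<in> grid_cell m x then 1 else 0) \<partial>lborel)"
      by (intro nn_integral_cong) (auto simp: indicator_def)
    finally show ?thesis by (simp add: measure_def)
  qed
  have meas: "(\<lambda>x. measure lborel (B \<inter> grid_cell m x)) \<in> borel_measurable borel"
    if [measurable]: "B \<in> sets borel" for B :: "'a set"
  proof -
    have "(\<lambda>x. \<integral>\<^sup>+y. (if y \<in> B \<and> y \<in> grid_cell m x then 1 else 0) \<partial>lborel)
        \<in> borel_measurable (lborel :: 'a measure)"
      by (rule lborel.borel_measurable_nn_integral) measurable
    then show ?thesis unfolding eq[OF that] by simp
  qed
  show ?thesis
    unfolding grid_average_def[abs_def]
    using meas[of E] meas[of UNIV] by (intro borel_measurable_divide) auto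
qed

lemma grid_average_nonneg: "0 \<le> grid_average m E x"
  by (simp add: grid_average_def)

lemma grid_average_le_1:
  assumes "E \<in> sets borel"
  shows "grid_average m E x \<le> 1"
proof -
  have "measure lborel (E \<inter> grid_cell m x) \<le> measure lborel (grid_cell m x)"
    using emeasure_grid_cell_finite[of m x] assms
    by (intro measure_mono_fmeasurable) (auto simp: fmeasurable_def)
  then show ?thesis
    unfolding grid_average_def by (simp add: divide_le_eq_1 zero_less_measure_iff)
qed

text \<open>The deviation of \<open>indicator E\<close> from its average over a cell is at most the average over that
  cell of the differences of two values, and two points of one cell differ by a short vector.\<close>

lemma grid_average_error:
  fixes E :: "'a::euclidean_space set" and m :: nat
  assumes [measurable]: "E \<in> sets borel"
  defines "\<rho> \<equiv> DIM('a) / real (Suc m)"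
  shows "(\<integral>\<^sup>+x. ennreal \<bar>indicator E x - grid_average m E x\<bar> \<partial>lborel)
    \<le> ennreal (real (Suc m) ^ DIM('a)) * (\<integral>\<^sup>+z\<in>cball 0 \<rho>. translation_gap (indicator E) z \<partial>lborel)"
proof -
  define k where "k = real (Suc m) ^ DIM('a)"
  define f :: "'a \<Rightarrow> real" where "f = indicator E"
  have [measurable]: "f \<in> borel_measurable borel" by (simp add: f_def)
  have [measurable]: "cball (0::'a) \<rho> \<in> sets borel" by simp
  have k: "k > 0" by (simp add: k_def)
  have pointwise: "ennreal \<bar>f x - grid_average m E x\<bar>
      \<le> ennreal k * (\<integral>\<^sup>+z. indicator (cball 0 \<rho>) z * ennreal \<bar>f (x + z) - f x\<bar> \<partial>lborel)" for x
  proof -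
    let ?c = "grid_cell m x"
    let ?D = "{y \<in> ?c. f y \<noteq> f x}"
    have D[measurable]: "?D \<in> sets borel" by measurable
    have fm: "B \<in> fmeasurable lborel" if "B \<subseteq> ?c" "B \<in> sets borel" for B
      using emeasure_mono[OF that(1), of lborel] emeasure_grid_cell_finite[of m x] that(2)
      by (auto simp: fmeasurable_def intro: le_less_trans)
    have ge: "1 / k \<le> measure lborel ?c"
      using measure_grid_cell_ge[of m x] by (simp add: k_def power_one_over)
    then have cpos: "measure lborel ?c > 0"
      using k by (meson less_le_trans zero_less_divide_1_iff)
    have "\<bar>f x - grid_average m E x\<bar> = measure lborel ?D / measure lborel ?c"
    proof (cases "x \<in> E")
      case True
      have "?D = ?c - (E \<inter> ?c)" using True by (auto simp: f_def indicator_def)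
      then have "measure lborel ?D = measure lborel ?c - measure lborel (E \<inter> ?c)"
        by (simp add: measurable_measure_Diff[OF fm])
      then show ?thesis
        using True cpos grid_average_le_1[of E m x]
        by (simp add: f_def grid_average_def diff_divide_distrib)
    next
      case False
      have "?D = E \<inter> ?c" using False by (auto simp: f_def indicator_def)
      then show ?thesis using False grid_average_nonneg[of m E x]
        by (simp add: f_def grid_average_def)
    qed
    also have "\<dots> \<le> k * measure lborel ?D"
    proof -
      have "1 / measure lborel ?c \<le> k" using ge k cpos by (simp add: field_simps)
      then show ?thesis
        using mult_right_mono[of "1 / measure lborel ?c" k "measure lborel ?D"] by simp
    qed
    finally have "ennreal \<bar>f x - grid_average m E x\<bar> \<le> ennreal (k * measure lborel ?D)"
      by (rule ennreal_leI)
    also have "\<dots> = ennreal k * emeasure lborel ?D"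
      using k fm[of ?D] by (simp add: ennreal_mult emeasure_eq_measure2)
    also have "emeasure lborel ?D = (\<integral>\<^sup>+y. indicator ?D y \<partial>lborel)"
      by simp
    also have "\<dots> = (\<integral>\<^sup>+z. indicator ?D (z + x) \<partial>lborel)"
      by (rule nn_integral_lborel_translate[symmetric]) simp
    also have "\<dots> \<le> (\<integral>\<^sup>+z. indicator (cball 0 \<rho>) z * ennreal \<bar>f (x + z) - f x\<bar> \<partial>lborel)"
    proof (rule nn_integral_mono)
      fix z
      show "indicator ?D (z + x) \<le> indicator (cball 0 \<rho>) z * ennreal \<bar>f (x + z) - f x\<bar>"
      proof (cases "z + x \<in> ?D")
        case True
        then have "norm z \<le> \<rho>" using grid_cell_diameter[of "z + x" m x] by (simp add: \<rho>_def)
        moreover have "\<bar>f (x + z) - f x\<bar> = 1"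
          using True by (auto simp: f_def indicator_def add.commute split: if_splits)
        ultimately show ?thesis by (simp add: indicator_def)
      qed simp
    qed
    finally show ?thesis by (simp add: mult_left_mono)
  qed
  have joint: "(\<lambda>(x, z). indicator (cball 0 \<rho>) z * ennreal \<bar>f (x + z) - f x\<bar>)
      \<in> borel_measurable (lborel \<Otimes>\<^sub>M lborel)"
    by measurable
  have "(\<integral>\<^sup>+x. ennreal \<bar>f x - grid_average m E x\<bar> \<partial>lborel)
      \<le> (\<integral>\<^sup>+x. ennreal k * (\<integral>\<^sup>+z. indicator (cball 0 \<rho>) z * ennreal \<bar>f (x + z) - f x\<bar> \<partial>lborel) \<partial>lborel)"
    by (rule nn_integral_mono) (rule pointwise)
  also have "\<dots> = ennreal k * (\<integral>\<^sup>+x. (\<integral>\<^sup>+z. indicator (cball 0 \<rho>) z * ennreal \<bar>f (x + z) - f x\<bar> \<partial>lborel) \<partial>lborel)"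
    by (rule nn_integral_cmult[OF lborel.borel_measurable_nn_integral[OF joint]])
  also have "(\<integral>\<^sup>+x. (\<integral>\<^sup>+z. indicator (cball 0 \<rho>) z * ennreal \<bar>f (x + z) - f x\<bar> \<partial>lborel) \<partial>lborel)
      = (\<integral>\<^sup>+z. (\<integral>\<^sup>+x. indicator (cball 0 \<rho>) z * ennreal \<bar>f (x + z) - f x\<bar> \<partial>lborel) \<partial>lborel)"
    by (rule lborel_pair.Fubini'[OF joint, symmetric])
  also have "\<dots> = (\<integral>\<^sup>+z\<in>cball 0 \<rho>. translation_gap f z \<partial>lborel)"
    unfolding translation_gap_def
    by (subst nn_integral_cmult) (auto simp: mult.commute)
  finally show ?thesis unfolding k_def f_def .
qed

text \<open>The number \<open>(m + 1)\<close> to the power of the dimension is cancelled, up to a constant, by the volume of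
  the ball of radius \<open>\<rho>\<close>, which is why the error is proportional to \<open>\<rho> + e\<close>, uniformly in \<open>m\<close>.\<close>

lemma grid_average_error_le:
  fixes E :: "'a::euclidean_space set" and m :: nat
  assumes E: "E \<in> sets borel" and K: "K \<ge> 0" and e: "e \<ge> 0"
    and gap: "\<And>h. translation_gap (indicator E) h \<le> ennreal (K * (norm h + e))"
  defines "\<rho> \<equiv> DIM('a) / real (Suc m)"
  shows "(\<integral>\<^sup>+x. ennreal \<bar>indicator E x - grid_average m E x\<bar> \<partial>lborel)
    \<le> ennreal (unit_ball_vol DIM('a) * DIM('a) ^ DIM('a) * K * (\<rho> + e))"
proof -
  have \<rho>: "\<rho> \<ge> 0" by (simp add: \<rho>_def)
  let ?\<omega> = "unit_ball_vol DIM('a)" and ?k = "real (Suc m) ^ DIM('a)"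
  have "(\<integral>\<^sup>+z\<in>cball (0::'a) \<rho>. translation_gap (indicator E) z \<partial>lborel)
      \<le> (\<integral>\<^sup>+z. ennreal (K * (\<rho> + e)) * indicator (cball (0::'a) \<rho>) z \<partial>lborel)"
  proof (rule nn_integral_mono)
    fix z :: 'a
    show "translation_gap (indicator E) z * indicator (cball 0 \<rho>) z
        \<le> ennreal (K * (\<rho> + e)) * indicator (cball 0 \<rho>) z"
      using order_trans[OF gap[of z] ennreal_leI[of _ "K * (\<rho> + e)"]] K
      by (cases "norm z \<le> \<rho>") (auto simp: indicator_def mult_left_mono)
  qed
  also have "\<dots> = ennreal (K * (\<rho> + e)) * emeasure lborel (cball (0::'a) \<rho>)"
    by (simp add: nn_integral_cmult_indicator)
  also have "\<dots> = ennreal (K * (\<rho> + e) * (?\<omega> * \<rho> ^ DIM('a)))"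
    using K e \<rho> by (simp add: emeasure_cball ennreal_mult)
  finally have "ennreal ?k * (\<integral>\<^sup>+z\<in>cball (0::'a) \<rho>. translation_gap (indicator E) z \<partial>lborel)
      \<le> ennreal ?k * ennreal (K * (\<rho> + e) * (?\<omega> * \<rho> ^ DIM('a)))"
    by (rule mult_left_mono) simp
  also have "\<dots> = ennreal (?k * (K * (\<rho> + e) * (?\<omega> * \<rho> ^ DIM('a))))"
    using K e \<rho> by (simp add: ennreal_mult)
  also have "?k * (K * (\<rho> + e) * (?\<omega> * \<rho> ^ DIM('a)))
      = ?\<omega> * DIM('a) ^ DIM('a) * K * (\<rho> + e)"
  proof -
    have "?k * \<rho> ^ DIM('a) = real DIM('a) ^ DIM('a)"
      unfolding \<rho>_def power_mult_distrib[symmetric] by simp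
    then have "?\<omega> * (?k * \<rho> ^ DIM('a)) * K * (\<rho> + e) = ?\<omega> * DIM('a) ^ DIM('a) * K * (\<rho> + e)"
      by simp
    then show ?thesis by (simp only: mult_ac)
  qed
  finally show ?thesis
    using grid_average_error[OF E, of m] unfolding \<rho>_def[symmetric] by (blast intro: order_trans)
qed

section \<open>Compactness of sets with small translation differences\<close>

text \<open>The averages of a set over all cells are countably many numbers in \<open>[0, 1]\<close>, so along a diagonal
  subsequence they converge pointwise on every grid, and by dominated convergence in \<open>L\<^sup>1\<close> on
  every ball. A fine grid makes the sets close to their averages, uniformly along the sequence.\<close>

lemma translation_gap_compact_cauchy:
  fixes E :: "nat \<Rightarrow> 'a::euclidean_space set"
  assumes E: "\<And>n. E n \<in> sets borel" and K: "K \<ge> 0" and e: "\<And>n. e n \<ge> 0" "e \<longlonglongrightarrow> 0"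
    and gap: "\<And>n h. translation_gap (indicator (E n)) h \<le> ennreal (K * (norm h + e n))"
  obtains r where "strict_mono (r :: nat \<Rightarrow> nat)"
    "\<And>R \<delta>. \<delta> > 0 \<Longrightarrow> \<exists>N. \<forall>k\<ge>N. \<forall>l\<ge>N.
       emeasure lborel {x \<in> cball 0 R. (x \<in> E (r k)) \<noteq> (x \<in> E (r l))} \<le> ennreal \<delta>"
proof -
  note [measurable] = E
  have bound: "norm (measure lborel (E n \<inter> Q) / measure lborel Q) \<le> 1"
    if Q: "Q \<in> (\<Union>m. range (grid_cell m))" for n Q
  proof -
    obtain m x where "Q = grid_cell m x" using Q by auto
    then have "measure lborel (E n \<inter> Q) / measure lborel Q = grid_average m (E n) x"
      by (simp add: grid_average_def)
    then show ?thesis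
      using grid_average_nonneg[of m "E n" x] grid_average_le_1[OF E, of m n x] by simp
  qed
  obtain r where r: "strict_mono (r :: nat \<Rightarrow> nat)"
    and conv: "\<And>Q. Q \<in> (\<Union>m. range (grid_cell m)) \<Longrightarrow>
        \<exists>l. (\<lambda>n. measure lborel (E (r n) \<inter> Q) / measure lborel Q) \<longlonglongrightarrow> l"
  proof (rule function_convergent_subsequence[where M = 1
        and f = "\<lambda>n Q. measure lborel (E n \<inter> Q) / measure lborel Q"])
    show "countable (\<Union>m. range (grid_cell m :: 'a \<Rightarrow> _))"
      by (auto intro: countable_range_grid_cell)
  qed (rule bound, assumption, rule that)
  define W where "W m x = lim (\<lambda>n. grid_average m (E (r n)) x)" for m and x :: 'a
  have W: "(\<lambda>n. grid_average m (E (r n)) x) \<longlonglongrightarrow> W m x" for m x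
  proof -
    have "grid_cell m x \<in> (\<Union>m. range (grid_cell m))" by blast
    from conv[OF this] show ?thesis
      unfolding W_def grid_average_def convergent_def[symmetric] convergent_LIMSEQ_iff .
  qed
  have W_meas[measurable]: "W m \<in> borel_measurable borel" for m
    by (rule borel_measurable_LIMSEQ_real[OF W]) simp
  define C where "C = unit_ball_vol DIM('a) * DIM('a) ^ DIM('a) * K"
  have C: "C \<ge> 0" using K by (simp add: C_def)
  have approx: "\<exists>m. \<forall>\<^sub>F n in sequentially.
      (\<integral>\<^sup>+x. indicator (cball 0 R) x * ennreal \<bar>indicator (E (r n)) x - W m x\<bar> \<partial>lborel) \<le> ennreal \<delta>"
    if \<delta>: "\<delta> > 0" for R \<delta>
  proof -
    have "(\<lambda>m. C * (DIM('a) / real (Suc m))) \<longlonglongrightarrow> C * 0"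
      by (intro tendsto_intros LIMSEQ_Suc lim_const_over_n)
    then have "\<forall>\<^sub>F m in sequentially. C * (DIM('a) / real (Suc m)) < \<delta> / 3"
      using \<delta> by (intro order_tendstoD(2)[where y=0]) auto
    then obtain m where m: "C * (DIM('a) / real (Suc m)) < \<delta> / 3"
      by (auto dest: eventually_happens)
    have "(\<lambda>n. C * e (r n)) \<longlonglongrightarrow> C * 0"
      using LIMSEQ_subseq_LIMSEQ[OF e(2) r] by (intro tendsto_intros) (simp add: o_def)
    then have ev1: "\<forall>\<^sub>F n in sequentially. C * e (r n) < \<delta> / 3"
      using \<delta> by (intro order_tendstoD(2)[where y=0]) auto
    let ?I = "indicator (cball (0::'a) R) :: 'a \<Rightarrow> real"
    have I[measurable]: "?I \<in> borel_measurable borel"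
      by (rule borel_measurable_indicator) simp
    have "(\<lambda>n. \<integral>\<^sup>+x. norm (?I x * W m x - ?I x * grid_average m (E (r n)) x) \<partial>lborel) \<longlonglongrightarrow> 0"
    proof (rule nn_integral_dominated_convergence_norm[where w = ?I])
      show "(\<lambda>x. ?I x * grid_average m (E (r i)) x) \<in> borel_measurable lborel" for i
        by simp
      show "(\<lambda>x. ?I x * W m x) \<in> borel_measurable lborel" by simp
      show "?I \<in> borel_measurable lborel" by simp
      show "AE x in lborel. norm (?I x * grid_average m (E (r j)) x) \<le> ?I x" for j
        using grid_average_nonneg[of m "E (r j)"] grid_average_le_1[OF E, of m "r j"]
        by (auto simp: indicator_def)
      have "(\<integral>\<^sup>+x. ennreal (?I x) \<partial>lborel) = emeasure lborel (cball (0::'a) R)"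
        by (simp add: ennreal_indicator)
      also have "\<dots> < \<infinity>" by (rule emeasure_bounded_finite) simp
      finally show "(\<integral>\<^sup>+x. ennreal (?I x) \<partial>lborel) < \<infinity>" .
      show "AE x in lborel. (\<lambda>i. ?I x * grid_average m (E (r i)) x) \<longlonglongrightarrow> ?I x * W m x"
        by (intro always_eventually allI tendsto_intros W)
    qed
    then have ev2: "\<forall>\<^sub>F n in sequentially.
        (\<integral>\<^sup>+x. norm (?I x * W m x - ?I x * grid_average m (E (r n)) x) \<partial>lborel) < ennreal (\<delta> / 3)"
      using \<delta> by (intro order_tendstoD(2)[where y=0]) auto
    have "\<forall>\<^sub>F n in sequentially.
      (\<integral>\<^sup>+x. indicator (cball 0 R) x * ennreal \<bar>indicator (E (r n)) x - W m x\<bar> \<partial>lborel) \<le> ennreal \<delta>"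
      using ev1 ev2
    proof eventually_elim
      case (elim n)
      let ?a = "grid_average m (E (r n))"
      have "(\<integral>\<^sup>+x. indicator (cball 0 R) x * ennreal \<bar>indicator (E (r n)) x - W m x\<bar> \<partial>lborel)
          \<le> (\<integral>\<^sup>+x. ennreal \<bar>indicator (E (r n)) x - ?a x\<bar>
                  + ennreal (norm (?I x * W m x - ?I x * ?a x)) \<partial>lborel)"
        by (intro nn_integral_mono) (auto simp: indicator_def simp flip: ennreal_plus)
      also have "\<dots> = (\<integral>\<^sup>+x. ennreal \<bar>indicator (E (r n)) x - ?a x\<bar> \<partial>lborel)
                  + (\<integral>\<^sup>+x. ennreal (norm (?I x * W m x - ?I x * ?a x)) \<partial>lborel)"
        by (rule nn_integral_add) simp_all
      also have "\<dots> \<le> ennreal (C * (DIM('a) / real (Suc m) + e (r n))) + ennreal (\<delta> / 3)"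
        using grid_average_error_le[OF E K e(1) gap, of "r n" m] less_imp_le[OF elim(2)]
        unfolding C_def by (rule add_mono)
      also have "\<dots> = ennreal (C * (DIM('a) / real (Suc m) + e (r n)) + \<delta> / 3)"
        using C e(1)[of "r n"] \<delta> by (intro ennreal_plus[symmetric]) auto
      also have "\<dots> \<le> ennreal \<delta>"
        using m elim(1) unfolding distrib_left by (intro ennreal_leI) linarith
      finally show ?case .
    qed
    then show ?thesis by blast
  qed
  have "\<exists>N. \<forall>k\<ge>N. \<forall>l\<ge>N.
       emeasure lborel {x \<in> cball 0 R. (x \<in> E (r k)) \<noteq> (x \<in> E (r l))} \<le> ennreal \<delta>"
    if \<delta>: "\<delta> > 0" for R \<delta>
  proof -
    let ?J = "\<lambda>m n x. indicator (cball (0::'a) R) x * ennreal \<bar>indicator (E (r n)) x - W m x\<bar>"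
    obtain m N where N: "\<And>n. n \<ge> N \<Longrightarrow> (\<integral>\<^sup>+x. ?J m n x \<partial>lborel) \<le> ennreal (\<delta> / 2)"
      using approx[of "\<delta> / 2" R] \<delta> unfolding eventually_sequentially by auto
    have J: "?J m n \<in> borel_measurable lborel" for m n
      by (intro borel_measurable_times_ennreal borel_measurable_indicator) auto
    have "emeasure lborel {x \<in> cball 0 R. (x \<in> E (r k)) \<noteq> (x \<in> E (r l))} \<le> ennreal \<delta>"
      if "k \<ge> N" "l \<ge> N" for k l
    proof -
      let ?D = "{x \<in> cball 0 R. (x \<in> E (r k)) \<noteq> (x \<in> E (r l))}"
      have "?D = cball 0 R \<inter> ((E (r k) - E (r l)) \<union> (E (r l) - E (r k)))" by auto
      then have "?D \<in> sets borel" using E by simp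
      then have "emeasure lborel ?D = (\<integral>\<^sup>+x. indicator ?D x \<partial>lborel)" by simp
      also have "\<dots> \<le> (\<integral>\<^sup>+x. ?J m k x + ?J m l x \<partial>lborel)"
      proof (intro nn_integral_mono)
        fix x
        show "indicator ?D x \<le> ?J m k x + ?J m l x"
        proof (cases "x \<in> ?D")
          case True
          have "(1::real) \<le> \<bar>indicator (E (r k)) x - W m x\<bar> + \<bar>indicator (E (r l)) x - W m x\<bar>"
            using True by (auto simp: indicator_def split: if_splits)
          then have "ennreal 1 \<le> ennreal (\<bar>indicator (E (r k)) x - W m x\<bar> + \<bar>indicator (E (r l)) x - W m x\<bar>)"
            by (rule ennreal_leI)
          then show ?thesis using True by simp
        qed simp
      qed
      also have "\<dots> = (\<integral>\<^sup>+x. ?J m k x \<partial>lborel) + (\<integral>\<^sup>+x. ?J m l x \<partial>lborel)"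
        by (rule nn_integral_add[OF J J])
      also have "\<dots> \<le> ennreal (\<delta> / 2) + ennreal (\<delta> / 2)"
        by (intro add_mono N that)
      also have "\<dots> = ennreal \<delta>"
        using \<delta> by (simp flip: ennreal_plus)
      finally show ?thesis .
    qed
    then show ?thesis by blast
  qed
  with r show ?thesis by (rule that)
qed

text \<open>A subsequence whose consecutive members differ on the ball of radius \<open>j\<close> by measure at most
  \<open>2 ^ - j\<close> is eventually constant at almost every point, by the Borel-Cantelli lemma. Since the
  functions are indicators, their limit is again the indicator of a set.\<close>

theorem translation_gap_compact:
  fixes E :: "nat \<Rightarrow> 'a::euclidean_space set"
  assumes E: "\<And>n. E n \<in> sets borel" and K: "K \<ge> 0" and e: "\<And>n. e n \<ge> 0" "e \<longlonglongrightarrow> 0"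
    and gap: "\<And>n h. translation_gap (indicator (E n)) h \<le> ennreal (K * (norm h + e n))"
  obtains r A where "strict_mono (r :: nat \<Rightarrow> nat)" "A \<in> sets borel"
    "AE x in lborel. \<forall>\<^sub>F n in sequentially. x \<in> E (r n) \<longleftrightarrow> x \<in> A"
    "\<And>h. translation_gap (indicator A) h \<le> ennreal (K * norm h)"
proof -
  note [measurable] = E
  obtain r0 where r0: "strict_mono (r0 :: nat \<Rightarrow> nat)"
    and cauchy: "\<And>R \<delta>. \<delta> > 0 \<Longrightarrow> \<exists>N. \<forall>k\<ge>N. \<forall>l\<ge>N.
       emeasure lborel {x \<in> cball 0 R. (x \<in> E (r0 k)) \<noteq> (x \<in> E (r0 l))} \<le> ennreal \<delta>"
    using translation_gap_compact_cauchy[OF E K e gap] by blast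
  have "\<exists>N. \<forall>k\<ge>N. \<forall>l\<ge>N. emeasure lborel
      {x \<in> cball 0 (real j). (x \<in> E (r0 k)) \<noteq> (x \<in> E (r0 l))} \<le> ennreal ((1/2) ^ j)" for j
    by (rule cauchy) simp
  then have "\<forall>j. \<exists>N. \<forall>k\<ge>N. \<forall>l\<ge>N. emeasure lborel
      {x \<in> cball 0 (real j). (x \<in> E (r0 k)) \<noteq> (x \<in> E (r0 l))} \<le> ennreal ((1/2) ^ j)" ..
  from choice[OF this] obtain N where N: "\<And>j k l. k \<ge> N j \<Longrightarrow> l \<ge> N j \<Longrightarrow> emeasure lborel
      {x \<in> cball 0 (real j). (x \<in> E (r0 k)) \<noteq> (x \<in> E (r0 l))} \<le> ennreal ((1/2) ^ j)"
    by blast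
  \<comment> \<open>The successors in the sum make the indices strictly increasing while \<open>r1 j\<close> stays above \<open>N j\<close>.\<close>
  define r1 where "r1 j = (\<Sum>i\<le>j. Suc (N i))" for j
  have r1: "strict_mono r1"
    by (rule strict_monoI_Suc) (simp add: r1_def)
  have r1N: "N j \<le> r1 j" for j
    using member_le_sum[of j "{..j}" "\<lambda>i. Suc (N i)"] by (simp add: r1_def)
  define r where "r = r0 \<circ> r1"
  have r: "strict_mono r" unfolding r_def using r0 r1 by (rule strict_mono_o)
  define B where "B j = {x \<in> cball 0 (real j). (x \<in> E (r j)) \<noteq> (x \<in> E (r (Suc j)))}" for j
  have "B j = cball 0 (real j) \<inter> ((E (r j) - E (r (Suc j))) \<union> (E (r (Suc j)) - E (r j)))" for j
    by (auto simp: B_def)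
  then have B[measurable]: "B j \<in> sets lborel" for j using E by simp
  have r1S: "r1 j \<le> r1 (Suc j)" for j by (simp add: r1_def)
  have small: "emeasure lborel (B j) \<le> ennreal ((1/2) ^ j)" for j
    unfolding B_def r_def o_def
    by (rule N) (use r1N[of j] r1S[of j] in auto)
  have "AE x in lborel. \<forall>\<^sub>F j in sequentially. x \<in> space lborel - B j"
  proof (rule borel_cantelli_AE1[OF B])
    show "emeasure lborel (B j) < \<infinity>" for j
      using small[of j] by (rule le_less_trans) simp
    show "summable (\<lambda>j. measure lborel (B j))"
    proof (rule summable_comparison_test')
      show "summable (\<lambda>j. (1/2::real) ^ j)" by (rule summable_geometric) simp
      show "norm (measure lborel (B j)) \<le> (1/2) ^ j" for j
        using enn2real_mono[OF small[of j]] by (simp add: measure_def)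
    qed
  qed
  then have stable: "AE x in lborel. \<exists>M. \<forall>n\<ge>M. x \<in> E (r n) \<longleftrightarrow> x \<in> E (r M)"
  proof eventually_elim
    case (elim x)
    have "\<forall>\<^sub>F j in sequentially. norm x \<le> real j"
      by (rule eventually_sequentiallyI[of "nat \<lceil>norm x\<rceil>"]) linarith
    with elim have "\<forall>\<^sub>F j in sequentially. (x \<in> E (r j)) = (x \<in> E (r (Suc j)))"
      by eventually_elim (auto simp: B_def)
    then obtain M where M: "\<And>j. j \<ge> M \<Longrightarrow> (x \<in> E (r j)) = (x \<in> E (r (Suc j)))"
      by (auto simp: eventually_sequentially)
    have "x \<in> E (r n) \<longleftrightarrow> x \<in> E (r M)" if "n \<ge> M" for n
      using that by (induction n rule: dec_induct) (use M in blast)+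
    then show ?case by blast
  qed
  define A where "A = {x. \<exists>M. \<forall>n\<ge>M. x \<in> E (r n)}"
  have "A = (\<Union>M. \<Inter>n\<in>{M..}. E (r n))" by (auto simp: A_def)
  then have A[measurable]: "A \<in> sets borel"
    using E by simp
  have lim: "AE x in lborel. \<forall>\<^sub>F n in sequentially. x \<in> E (r n) \<longleftrightarrow> x \<in> A"
    using stable
  proof eventually_elim
    case (elim x)
    then obtain M where M: "\<And>n. n \<ge> M \<Longrightarrow> x \<in> E (r n) \<longleftrightarrow> x \<in> E (r M)" by blast
    have "x \<in> A \<longleftrightarrow> x \<in> E (r M)"
    proof
      assume "x \<in> A"
      then obtain M' where "\<And>n. n \<ge> M' \<Longrightarrow> x \<in> E (r n)" by (auto simp: A_def)
      then show "x \<in> E (r M)" using M[of "max M M'"] by simp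
    next
      assume "x \<in> E (r M)"
      then have "\<forall>n\<ge>M. x \<in> E (r n)" using M by blast
      then show "x \<in> A" unfolding A_def by blast
    qed
    then show ?case using M unfolding eventually_sequentially by blast
  qed
  have "translation_gap (indicator A) h \<le> ennreal (K * norm h)" for h
  proof -
    let ?g = "\<lambda>B x. ennreal \<bar>indicator B (x + h) - indicator B x\<bar>"
    have "translation_gap (indicator A) h \<le> (\<integral>\<^sup>+x. liminf (\<lambda>n. ?g (E (r n)) x) \<partial>lborel)"
      unfolding translation_gap_def
    proof (rule nn_integral_mono_AE)
      show "AE x in lborel. ?g A x \<le> liminf (\<lambda>n. ?g (E (r n)) x)"
        using lim AE_lborel_translate[OF lim, of h]
      proof eventually_elim
        case (elim x)
        from elim have "\<forall>\<^sub>F n in sequentially. ?g A x \<le> ?g (E (r n)) x"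
          by eventually_elim (simp add: indicator_def)
        then show ?case by (rule Liminf_bounded)
      qed
    qed
    also have "\<dots> \<le> liminf (\<lambda>n. translation_gap (indicator (E (r n))) h)"
      unfolding translation_gap_def
      by (rule nn_integral_liminf) measurable
    also have "\<dots> \<le> liminf (\<lambda>n. ennreal (K * (norm h + e (r n))))"
      by (intro Liminf_mono always_eventually allI gap)
    also have "\<dots> = ennreal (K * norm h)"
    proof (rule lim_imp_Liminf)
      have "(\<lambda>n. ennreal (K * (norm h + e (r n)))) \<longlonglongrightarrow> ennreal (K * (norm h + 0))"
        using LIMSEQ_subseq_LIMSEQ[OF e(2) r] by (intro tendsto_intros tendsto_ennrealI) (simp add: o_def)
      then show "(\<lambda>n. ennreal (K * (norm h + e (r n)))) \<longlonglongrightarrow> ennreal (K * norm h)" by simp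
    qed simp
    finally show ?thesis .
  qed
  then show ?thesis using r A lim that by blast
qed

section \<open>A space-filling curve with a Borel right inverse\<close>

text \<open>A continuous function of period \<open>2\<close> that is \<open>0\<close> on \<open>[0, 1/3]\<close> and \<open>1\<close> on \<open>[2/3, 1]\<close>: on a point of
  the Cantor set it takes the value of half the first ternary digit.\<close>

definition bump :: "real \<Rightarrow> real" where
  "bump t = max 0 (min 1 (1 / 2 - cos (pi * t)))"

lemma continuous_on_bump [continuous_intros]:
  fixes f :: "real \<Rightarrow> real"
  assumes "continuous_on S f"
  shows "continuous_on S (\<lambda>x. bump (f x))"
  unfolding bump_def by (intro continuous_intros assms)

lemma bump_bounds: "0 \<le> bump t" "bump t \<le> 1"
  by (auto simp: bump_def)

lemma bump_periodic: "bump (2 * real k + t) = bump t"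
proof -
  have "cos (pi * (2 * real k + t)) = cos (pi * t + of_nat k * (2 * of_real pi))"
    by (simp add: algebra_simps)
  also have "\<dots> = cos (pi * t)" by (rule cos.plus_of_nat)
  finally show ?thesis by (simp add: bump_def)
qed

lemma bump_eq_0: "bump t = 0" if "0 \<le> t" "t \<le> 1 / 3"
proof -
  have "cos (pi / 3) \<le> cos (pi * t)"
    using that by (intro cos_monotone_0_pi_le) (auto simp: field_simps)
  then show ?thesis by (simp add: bump_def cos_60)
qed

lemma bump_eq_1: "bump t = 1" if "2 / 3 \<le> t" "t \<le> 1"
proof -
  have "pi * (2 / 3) \<le> pi * t" "pi * t \<le> pi * 1"
    using that by (intro mult_left_mono; simp)+
  then have "cos (pi * t) \<le> cos (pi * (2 / 3))"
    by (intro cos_monotone_0_pi_le) auto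
  moreover have "cos (pi * (2 / 3)) = - 1 / 2" using cos_120' by simp
  ultimately show ?thesis by (simp add: bump_def)
qed

text \<open>The point of the Cantor set with ternary digits \<open>2 a\<^sub>0, 2 a\<^sub>1, \<dots>\<close>.\<close>

definition cantor_point :: "(nat \<Rightarrow> nat) \<Rightarrow> real" where
  "cantor_point a = (\<Sum>m. 2 * real (a m) / 3 ^ Suc m)"

context
  fixes a :: "nat \<Rightarrow> nat"
  assumes digits: "\<And>m. a m \<le> 1"
begin

lemma summable_cantor_point: "summable (\<lambda>m. 2 * real (a m) / 3 ^ Suc m)"
proof (rule summable_comparison_test')
  show "summable (\<lambda>m. (2 / 3) * (1 / 3 :: real) ^ m)"
    by (intro summable_mult summable_geometric) simp
  fix m
  have "real (a m) \<le> 1" using digits[of m] by simp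
  then show "norm (2 * real (a m) / 3 ^ Suc m) \<le> (2 / 3) * (1 / 3) ^ m"
    by (simp add: field_simps)
qed

lemma cantor_point_bounds: "0 \<le> cantor_point a" "cantor_point a \<le> 1"
proof -
  show "0 \<le> cantor_point a"
    unfolding cantor_point_def by (intro suminf_nonneg summable_cantor_point) simp
  have s: "(\<lambda>m. (2 / 3) * (1 / 3 :: real) ^ m) sums ((2 / 3) * (1 / (1 - 1 / 3)))"
    by (intro sums_mult geometric_sums) simp
  have "cantor_point a \<le> (\<Sum>m. (2 / 3) * (1 / 3 :: real) ^ m)"
    unfolding cantor_point_def
  proof (intro suminf_le summable_cantor_point)
    show "summable (\<lambda>m. (2 / 3) * (1 / 3 :: real) ^ m)" using s by (rule sums_summable)
    fix m
    have "real (a m) \<le> 1" using digits[of m] by simp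
    then show "2 * real (a m) / 3 ^ Suc m \<le> (2 / 3) * (1 / 3) ^ m"
      by (simp add: field_simps)
  qed
  also have "\<dots> = 1" using sums_unique[OF s] by simp
  finally show "cantor_point a \<le> 1" .
qed

lemma cantor_point_shift: "3 * cantor_point a = 2 * real (a 0) + cantor_point (\<lambda>m. a (Suc m))"
proof -
  have "cantor_point (\<lambda>m. a (Suc m)) = (\<Sum>m. 3 * (2 * real (a (Suc m)) / 3 ^ Suc (Suc m)))"
    unfolding cantor_point_def by (intro suminf_cong) simp
  also have "\<dots> = 3 * (\<Sum>m. 2 * real (a (Suc m)) / 3 ^ Suc (Suc m))"
    using summable_cantor_point by (intro suminf_mult) (subst summable_Suc_iff)
  also have "\<dots> = 3 * (cantor_point a - 2 * real (a 0) / 3 ^ Suc 0)"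
    unfolding cantor_point_def by (subst suminf_split_head[OF summable_cantor_point]) simp
  finally show ?thesis by simp
qed

end

text \<open>Multiplication by \<open>3 ^ m\<close> shifts the ternary expansion, up to an even integer, so the bump
  reads off the digit number \<open>m\<close>.\<close>

lemma bump_cantor_point:
  assumes "\<And>m. a m \<le> 1"
  shows "bump (3 ^ m * cantor_point a) = real (a m)"
  using assms
proof (induction m arbitrary: a)
  case 0
  let ?s = "cantor_point (\<lambda>m. a (Suc m))"
  have s: "0 \<le> ?s" "?s \<le> 1" "3 * cantor_point a = 2 * real (a 0) + ?s"
    using cantor_point_bounds[of "\<lambda>m. a (Suc m)"] cantor_point_shift[of a] 0 by auto
  have "a 0 = 0 \<or> a 0 = 1" using 0[of 0] by auto
  then show ?case
  proof
    assume "a 0 = 0"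
    then show ?thesis using s bump_eq_0[of "cantor_point a"] by simp
  next
    assume "a 0 = 1"
    then show ?thesis using s bump_eq_1[of "cantor_point a"] by simp
  qed
next
  case (Suc m)
  have "3 ^ Suc m * cantor_point a = 3 ^ m * (3 * cantor_point a)" by simp
  also have "\<dots> = 2 * real (3 ^ m * a 0) + 3 ^ m * cantor_point (\<lambda>m. a (Suc m))"
    unfolding cantor_point_shift[OF Suc.prems] by (simp add: distrib_left)
  finally have "bump (3 ^ Suc m * cantor_point a) = bump (3 ^ m * cantor_point (\<lambda>m. a (Suc m)))"
    by (simp only: bump_periodic)
  also have "\<dots> = real (a (Suc m))" using Suc by simp
  finally show ?case .
qed

lemma binary_expansion:
  fixes x :: real
  assumes x: "0 \<le> x" "x < 1"
  obtains b :: "nat \<Rightarrow> nat" where "\<And>n. b n \<le> 1" "(\<lambda>n. real (b n) / 2 ^ Suc n) sums x"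
proof -
  define f where "f n = \<lfloor>2 ^ n * x\<rfloor>" for n :: nat
  have f: "f (Suc n) - 2 * f n \<in> {0, 1}" for n
  proof -
    have eq: "2 ^ Suc n * x = 2 * (2 ^ n * x)" by simp
    show ?thesis unfolding f_def eq by (auto, linarith)
  qed
  define b where "b n = nat (f (Suc n) - 2 * f n)" for n
  have b: "real (b n) = of_int (f (Suc n)) - 2 * of_int (f n)" for n
    using f[of n] by (auto simp: b_def)
  have "(\<lambda>n. of_int (f n) / 2 ^ n) \<longlonglongrightarrow> x"
  proof (rule real_tendsto_sandwich)
    have "of_int (f n) / 2 ^ n \<le> x \<and> x - (1 / 2) ^ n \<le> of_int (f n) / 2 ^ n" for n
    proof -
      have "of_int (f n) \<le> 2 ^ n * x" "2 ^ n * x - 1 \<le> of_int (f n)"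
        unfolding f_def by linarith+
      then have "of_int (f n) / 2 ^ n \<le> (2 ^ n * x) / 2 ^ n" "(2 ^ n * x - 1) / 2 ^ n \<le> of_int (f n) / 2 ^ n"
        by (intro divide_right_mono; simp)+
      then show ?thesis by (simp add: diff_divide_distrib power_one_over)
    qed
    then show "\<forall>\<^sub>F n in sequentially. x - (1 / 2) ^ n \<le> of_int (f n) / 2 ^ n"
      "\<forall>\<^sub>F n in sequentially. of_int (f n) / 2 ^ n \<le> x" by auto
    have "(\<lambda>n. x - (1 / 2) ^ n) \<longlonglongrightarrow> x - 0"
      by (intro tendsto_intros LIMSEQ_power_zero) simp
    then show "(\<lambda>n. x - (1 / 2) ^ n) \<longlonglongrightarrow> x" by simp
  qed simp
  from telescope_sums[OF this]
  have "(\<lambda>n. of_int (f (Suc n)) / 2 ^ Suc n - of_int (f n) / 2 ^ n) sums (x - of_int (f 0))"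
    by simp
  moreover have "f 0 = 0" using x by (simp add: f_def floor_eq_iff)
  moreover have "of_int (f (Suc n)) / 2 ^ Suc n - of_int (f n) / 2 ^ n = real (b n) / 2 ^ Suc n" for n
    by (simp add: b field_simps)
  ultimately have "(\<lambda>n. real (b n) / 2 ^ Suc n) sums x" by simp
  moreover have "b n \<le> 1" for n using f[of n] by (auto simp: b_def)
  ultimately show ?thesis using that by blast
qed

text \<open>The coordinate number \<open>j\<close> of Schoenberg's space-filling curve in dimension \<open>d\<close>. At a point of the
  Cantor set the numbers \<open>bump (3 ^ m * t)\<close> are prescribed digits, and those with
  \<open>m mod d = j\<close> serve as the binary digits of this coordinate.\<close>

definition schoenberg_coordinate :: "nat \<Rightarrow> nat \<Rightarrow> real \<Rightarrow> real" where
  "schoenberg_coordinate d j t = (\<Sum>n. bump (3 ^ (d * n + j) * t) / 2 ^ Suc n)"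

lemma continuous_on_schoenberg_coordinate: "continuous_on UNIV (schoenberg_coordinate d j)"
proof -
  let ?f = "\<lambda>n t. bump (3 ^ (d * n + j) * t) / 2 ^ Suc n"
  have "uniform_limit UNIV (\<lambda>N t. \<Sum>n<N. ?f n t) (\<lambda>t. \<Sum>n. ?f n t) sequentially"
  proof (rule Weierstrass_m_test)
    show "norm (?f n t) \<le> (1 / 2) ^ Suc n" for n t
      using bump_bounds[of "3 ^ (d * n + j) * t"] by (simp add: power_one_over divide_right_mono)
    show "summable (\<lambda>n. (1 / 2 :: real) ^ Suc n)"
      by (subst summable_Suc_iff) (simp add: summable_geometric)
  qed
  then show ?thesis
    unfolding schoenberg_coordinate_def[abs_def]
    by (rule uniform_limit_theorem[rotated]) (auto intro!: always_eventually continuous_intros)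
qed

text \<open>Given a point of the cube, the binary digits of its coordinates are interleaved into one sequence,
  and the curve passes through the point at the Cantor point with these digits.\<close>

lemma space_filling_curve:
  obtains g :: "real \<Rightarrow> 'a::euclidean_space"
  where "continuous_on UNIV g" "\<And>y. y \<in> box 0 One \<Longrightarrow> y \<in> g ` {0..1}"
proof -
  let ?d = "DIM('a)"
  obtain idx :: "'a \<Rightarrow> nat" where idx: "bij_betw idx Basis {0..<?d}"
    using ex_bij_betw_finite_nat[OF finite_Basis] by blast
  define g where "g t = (\<Sum>b\<in>Basis. schoenberg_coordinate ?d (idx b) t *\<^sub>R b)" for t :: real
  have "continuous_on UNIV g"
    unfolding g_def[abs_def] by (intro continuous_intros continuous_on_schoenberg_coordinate)
  moreover have "y \<in> g ` {0..1}" if y: "y \<in> box 0 One" for y :: 'a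
  proof -
    have "\<exists>\<beta> :: nat \<Rightarrow> nat. (\<forall>n. \<beta> n \<le> 1) \<and> (\<lambda>n. real (\<beta> n) / 2 ^ Suc n) sums (y \<bullet> b)"
      if "b \<in> Basis" for b
    proof -
      have "0 \<le> y \<bullet> b" "y \<bullet> b < 1" using y that by (auto simp: box_def)
      then show ?thesis using binary_expansion[of "y \<bullet> b"] by blast
    qed
    then obtain \<beta> :: "'a \<Rightarrow> nat \<Rightarrow> nat"
      where \<beta>: "\<And>b n. b \<in> Basis \<Longrightarrow> \<beta> b n \<le> 1"
        "\<And>b. b \<in> Basis \<Longrightarrow> (\<lambda>n. real (\<beta> b n) / 2 ^ Suc n) sums (y \<bullet> b)"
      by metis
    define a where "a m = \<beta> (inv_into Basis idx (m mod ?d)) (m div ?d)" for m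
    have inv: "inv_into Basis idx (m mod ?d) \<in> Basis" for m
      using idx by (intro inv_into_into) (auto simp: bij_betw_def)
    have a1: "a m \<le> 1" for m unfolding a_def by (rule \<beta>(1)[OF inv])
    have coord: "schoenberg_coordinate ?d (idx b) (cantor_point a) = y \<bullet> b" if b: "b \<in> Basis" for b
    proof -
      have "idx b < ?d" using idx b by (auto simp: bij_betw_def)
      then have "a (?d * n + idx b) = \<beta> b n" for n
        unfolding a_def using idx b by (simp add: bij_betw_def)
      then show ?thesis
        unfolding schoenberg_coordinate_def bump_cantor_point[OF a1]
        using \<beta>(2)[OF b] by (simp add: sums_iff)
    qed
    have "g (cantor_point a) = y"
      unfolding g_def by (simp add: coord euclidean_representation)
    then show ?thesis using cantor_point_bounds[OF a1] by force
  qed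
  ultimately show ?thesis by (rule that)
qed

text \<open>The first time at which the curve reaches a point is a right inverse, and it is lower
  semicontinuous, hence Borel: its sublevel sets are images of compact intervals, or everything.\<close>

lemma borel_section:
  fixes g :: "real \<Rightarrow> 'a::euclidean_space"
  assumes g: "continuous_on UNIV g"
  obtains h where "h \<in> borel_measurable borel" "\<And>y. h y \<in> {0..1}"
    "\<And>y. y \<in> g ` {0..1} \<Longrightarrow> g (h y) = y"
proof -
  \<comment> \<open>The added time \<open>1\<close> only provides a value at the points that the curve does not reach.\<close>
  define S where "S y = insert 1 {t\<in>{0..1}. g t = y}" for y
  define h where "h y = Inf (S y)" for y
  have S: "closed (S y)" "S y \<subseteq> {0..1}" "S y \<noteq> {}" for y
  proof -
    have "closed ({0..1} \<inter> g -` {y})"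
      by (rule continuous_closed_preimage[OF continuous_on_subset[OF g]]) auto
    moreover have "{0..1} \<inter> g -` {y} = {t\<in>{0..1}. g t = y}" by auto
    ultimately show "closed (S y)" unfolding S_def by simp
  qed (auto simp: S_def)
  have bdd: "bdd_below (S y)" for y
    using S(2) by (rule bdd_below_mono[rotated]) simp
  have hS: "h y \<in> S y" for y
    unfolding h_def by (rule closed_contains_Inf[OF S(3) bdd S(1)])
  have low: "h y \<le> t" if "t \<in> S y" for t y
    unfolding h_def by (rule cInf_lower[OF that bdd])
  have "{y. h y \<le> c} \<in> sets borel" for c
  proof (cases "c < 1")
    case True
    have "{y. h y \<le> c} = g ` ({0..1} \<inter> {..c})"
    proof (intro equalityI subsetI)
      fix y assume "y \<in> {y. h y \<le> c}"
      with hS[of y] True have "h y \<in> {0..1} \<inter> {..c}" "g (h y) = y" by (auto simp: S_def)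
      then show "y \<in> g ` ({0..1} \<inter> {..c})" by force
    next
      fix y assume "y \<in> g ` ({0..1} \<inter> {..c})"
      then obtain t where "t \<in> {0..1}" "t \<le> c" "g t = y" by auto
      then have "t \<in> S y" "t \<le> c" by (simp_all add: S_def)
      then show "y \<in> {y. h y \<le> c}" using low[of t y] by auto
    qed
    moreover have "compact (g ` ({0..1} \<inter> {..c}))"
      by (intro compact_continuous_image continuous_on_subset[OF g] compact_Int_closed) auto
    ultimately show ?thesis by (simp add: borel_compact)
  next
    case False
    then have "h y \<le> c" for y using low[of 1 y] by (simp add: S_def)
    then show ?thesis by simp
  qed
  then have "h \<in> borel_measurable borel" by (simp add: borel_measurable_iff_le)
  moreover have "h y \<in> {0..1}" for y using hS S(2) by blast
  moreover have "g (h y) = y" if y: "y \<in> g ` {0..1}" for y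
  proof -
    obtain t where t: "t \<in> {0..1}" "g t = y" using y by auto
    then have "h y \<le> t" by (intro low) (auto simp: S_def)
    then show ?thesis using hS[of y] t by (auto simp: S_def)
  qed
  ultimately show ?thesis by (rule that)
qed

section \<open>Vague compactness of measures\<close>

text \<open>The curve fills a bounded cube, so the whole space is first mapped homeomorphically onto the open
  unit cube; \<open>expand\<close> is the inverse on that cube.\<close>

definition compress :: "'a::euclidean_space \<Rightarrow> 'a" where
  "compress x = (\<Sum>b\<in>Basis. (1 / 2 + arctan (x \<bullet> b) / pi) *\<^sub>R b)"

definition expand :: "'a::euclidean_space \<Rightarrow> 'a" where
  "expand y = (\<Sum>b\<in>Basis. tan (pi * (y \<bullet> b - 1 / 2)) *\<^sub>R b)"

lemma continuous_on_compress: "continuous_on UNIV compress"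
  unfolding compress_def[abs_def] by (intro continuous_intros) auto

lemma compress_in_box: "compress x \<in> box 0 One"
proof -
  have "0 < 1 / 2 + arctan t / pi" "1 / 2 + arctan t / pi < 1" for t
    using arctan_bounded[of t] by (auto simp: field_simps)
  then show ?thesis by (auto simp: box_def compress_def)
qed

lemma expand_compress: "expand (compress x) = x"
proof (rule euclidean_eqI)
  fix b :: 'a assume b: "b \<in> Basis"
  have "pi * (1 / 2 + arctan (x \<bullet> b) / pi - 1 / 2) = arctan (x \<bullet> b)" by simp
  then show "expand (compress x) \<bullet> b = x \<bullet> b"
    using b by (simp add: expand_def compress_def tan_arctan)
qed

lemma compress_expand:
  assumes "y \<in> box 0 One"
  shows "compress (expand y) = y"
proof (rule euclidean_eqI)
  fix b :: 'a assume b: "b \<in> Basis"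
  then have "0 < y \<bullet> b" "y \<bullet> b < 1" using assms by (auto simp: box_def)
  then have "0 < pi * (y \<bullet> b)" "pi * (y \<bullet> b) < pi" by auto
  then have "- (pi / 2) < pi * (y \<bullet> b - 1 / 2)" "pi * (y \<bullet> b - 1 / 2) < pi / 2"
    by (auto simp: algebra_simps)
  then show "compress (expand y) \<bullet> b = y \<bullet> b"
    using b by (simp add: expand_def compress_def arctan_tan)
qed

lemma continuous_on_expand: "continuous_on (box 0 One) (expand :: 'a::euclidean_space \<Rightarrow> 'a)"
  unfolding expand_def[abs_def]
proof (intro continuous_on_sum continuous_at_imp_continuous_on ballI)
  fix b y :: 'a assume b: "b \<in> Basis" and y: "y \<in> box 0 One"
  then have "0 < y \<bullet> b" "y \<bullet> b < 1" by (auto simp: box_def)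
  then have "0 < pi * (y \<bullet> b)" "pi * (y \<bullet> b) < pi" by auto
  then have "- (pi / 2) < pi * (y \<bullet> b - 1 / 2)" "pi * (y \<bullet> b - 1 / 2) < pi / 2"
    by (auto simp: algebra_simps)
  then have "cos (pi * (y \<bullet> b - 1 / 2)) \<noteq> 0"
    using cos_gt_zero_pi[of "pi * (y \<bullet> b - 1 / 2)"] by linarith
  then show "isCont (\<lambda>y. tan (pi * (y \<bullet> b - 1 / 2)) *\<^sub>R b) y"
    by (intro continuous_intros isCont_o2[where g = tan, OF _ isCont_tan]) auto
qed

lemma measurable_expand: "expand \<in> borel_measurable borel"
  unfolding expand_def[abs_def] tan_def by measurable

text \<open>A compactly supported function on the space becomes, on the closed unit cube, a continuous function
  that vanishes near the boundary. Mass that escapes to infinity accumulates on the boundary of the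
  cube, where it is not seen by such functions.\<close>

lemma compact_support_pullback:
  fixes \<phi> :: "'a::euclidean_space \<Rightarrow> real"
  assumes \<phi>: "continuous_on UNIV \<phi>" and K: "compact K" "\<And>x. x \<notin> K \<Longrightarrow> \<phi> x = 0"
  defines "\<psi> \<equiv> \<lambda>y. if y \<in> box 0 One then \<phi> (expand y) else 0"
  shows "continuous_on UNIV \<psi>" "\<exists>B. \<forall>y. \<bar>\<psi> y\<bar> \<le> B"
proof -
  let ?K = "compress ` K"
  have "compact ?K"
    by (rule compact_continuous_image[OF continuous_on_subset[OF continuous_on_compress] K(1)]) simp
  then have op: "open (- ?K)" by (simp add: compact_imp_closed open_Compl)
  have zero: "\<psi> y = 0" if "y \<notin> ?K" for y
  proof (cases "y \<in> box 0 One")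
    case True
    have "expand y \<notin> K" using that compress_expand[OF True] by (metis image_eqI)
    then show ?thesis using K(2) by (simp add: \<psi>_def)
  qed (auto simp: \<psi>_def)
  have "continuous_on (box 0 One) (\<lambda>y. \<phi> (expand y))"
    by (rule continuous_on_compose2[OF \<phi> continuous_on_expand]) simp
  then have 1: "continuous_on (box 0 One) \<psi>"
    by (rule continuous_on_eq) (simp add: \<psi>_def)
  have 2: "continuous_on (- ?K) \<psi>"
    by (rule continuous_on_eq[OF continuous_on_const[of _ 0]]) (simp add: zero)
  have "continuous_on (box 0 One \<union> - ?K) \<psi>"
    using continuous_on_open_Un[OF open_box op 1 2] .
  moreover have "box 0 One \<union> - ?K = UNIV" using compress_in_box by auto
  ultimately show "continuous_on UNIV \<psi>" by simp
  have "bounded (\<phi> ` K)"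
    by (intro compact_imp_bounded compact_continuous_image continuous_on_subset[OF \<phi>] K) simp
  then obtain B where B: "\<And>x. x \<in> K \<Longrightarrow> \<bar>\<phi> x\<bar> \<le> B"
    by (auto simp: bounded_iff)
  have "\<bar>\<psi> y\<bar> \<le> max 0 B" for y
    using B[of "expand y"] K(2)[of "expand y"] by (cases "expand y \<in> K") (auto simp: \<psi>_def)
  then show "\<exists>B. \<forall>y. \<bar>\<psi> y\<bar> \<le> B" by blast
qed

text \<open>Transported to the line by the Borel right inverse, the measures live on \<open>[0, 1]\<close> and are tight,
  so Helly's theorem applies. The continuous curve transports the weak limit back.
  The limit may have total mass below one, since the part on the boundary of the cube is dropped.\<close>

lemma prob_space_vague_compact:
  fixes N :: "nat \<Rightarrow> 'a::euclidean_space measure"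
  assumes N: "\<And>n. prob_space (N n)" "\<And>n. sets (N n) = sets borel"
  obtains r M where "strict_mono (r :: nat \<Rightarrow> nat)" "finite_measure M" "sets M = sets borel"
    "\<And>\<phi> K. continuous_on UNIV \<phi> \<Longrightarrow> compact K \<Longrightarrow> (\<And>x. x \<notin> K \<Longrightarrow> \<phi> x = 0) \<Longrightarrow>
       (\<lambda>n. LINT x|N (r n). \<phi> x) \<longlonglongrightarrow> (LINT x|M. (\<phi> x :: real))"
proof -
  obtain g :: "real \<Rightarrow> 'a" where g: "continuous_on UNIV g" "\<And>y. y \<in> box 0 One \<Longrightarrow> y \<in> g ` {0..1}"
    using space_filling_curve by blast
  obtain h where [measurable]: "h \<in> borel_measurable borel" and h: "\<And>y. h y \<in> {0..1}"
    "\<And>y. y \<in> g ` {0..1} \<Longrightarrow> g (h y) = y"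
    using borel_section[OF g(1)] by blast
  note [measurable] = borel_measurable_continuous_onI[OF g(1)] measurable_expand
    borel_measurable_continuous_onI[OF continuous_on_compress]
  have gh: "g (h (compress x)) = compress x" for x
    by (intro h(2) g(2) compress_in_box)
  have hN: "(\<lambda>x. h (compress x)) \<in> measurable (N n) borel" for n
    unfolding measurable_cong_sets[OF N(2) refl] by measurable
  define \<rho> where "\<rho> n = distr (N n) borel (\<lambda>x. h (compress x))" for n
  \<comment> \<open>Integrals against \<open>\<rho> n\<close> of functions of \<open>g\<close> are integrals against \<open>N n\<close>, as \<open>g\<close> undoes \<open>h\<close>.\<close>
  have real_\<rho>: "real_distribution (\<rho> n)" for n
    unfolding \<rho>_def using prob_space.real_distribution_distr[OF N(1) hN] .
  have "tight \<rho>"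
    unfolding tight_def
  proof (intro conjI allI impI real_\<rho>)
    fix \<epsilon> :: real assume \<epsilon>: "\<epsilon> > 0"
    have "measure (\<rho> n) {-1<..1} = 1" for n
    proof -
      have "h (compress x) \<in> {-1<..1}" for x using h(1)[of "compress x"] by auto
      then have "(\<lambda>x. h (compress x)) -` {-1<..1} \<inter> space (N n) = space (N n)" by auto
      then show ?thesis
        unfolding \<rho>_def by (simp add: measure_distr[OF hN] prob_space.prob_space[OF N(1)])
    qed
    then show "\<exists>a b. a < b \<and> (\<forall>n. 1 - \<epsilon> < measure (\<rho> n) {a<..b})"
      using \<epsilon> by (intro exI[of _ "-1"] exI[of _ 1]) simp
  qed
  from tight_imp_convergent_subsubsequence[OF this strict_mono_id]
  obtain r R where r: "strict_mono r" and R: "real_distribution R" and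
    weak: "weak_conv_m (\<lambda>n. \<rho> (r n)) R"
    by (auto simp: o_def)
  interpret R: real_distribution R by fact
  define M where
    "M = distr (density R (indicator {t. g t \<in> box 0 One})) borel (\<lambda>t. expand (g t))"
  have [measurable]: "{t. g t \<in> box 0 One} \<in> sets borel"
    using open_vimage[OF open_box g(1)] by (simp add: vimage_def)
  have "finite_measure (density R (indicator {t. g t \<in> box 0 One}))"
    by (rule R.finite_measure_restricted) simp
  then have "finite_measure M"
    unfolding M_def by (rule finite_measure.finite_measure_distr) measurable
  moreover have "sets M = sets borel" by (simp add: M_def)
  moreover have "(\<lambda>n. LINT x|N (r n). \<phi> x) \<longlonglongrightarrow> (LINT x|M. \<phi> x)"
    if \<phi>: "continuous_on UNIV \<phi>" "compact K" "\<And>x. x \<notin> K \<Longrightarrow> \<phi> x = 0" for \<phi> :: "'a \<Rightarrow> real" and K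
  proof -
    define \<psi> where "\<psi> y = (if y \<in> box 0 One then \<phi> (expand y) else 0)" for y
    have \<psi>: "continuous_on UNIV \<psi>" and "\<exists>B. \<forall>y. \<bar>\<psi> y\<bar> \<le> B"
      using compact_support_pullback[OF \<phi>] unfolding \<psi>_def[abs_def] by blast+
    then obtain B where B: "\<And>y. \<bar>\<psi> y\<bar> \<le> B" by blast
    note [measurable] = borel_measurable_continuous_onI[OF \<phi>(1)] borel_measurable_continuous_onI[OF \<psi>]
    have "continuous_on UNIV (\<lambda>t. \<psi> (g t))"
      by (rule continuous_on_compose2[OF \<psi> g(1)]) simp
    then have cont: "isCont (\<lambda>t. \<psi> (g t)) t" for t
      by (simp add: continuous_on_eq_continuous_at)
    have 1: "(LINT t|\<rho> n. \<psi> (g t)) = (LINT x|N n. \<phi> x)" for n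
    proof -
      have "(LINT t|\<rho> n. \<psi> (g t)) = (LINT x|N n. \<psi> (g (h (compress x))))"
        unfolding \<rho>_def by (rule integral_distr[OF hN]) measurable
      then show ?thesis unfolding gh by (simp add: \<psi>_def expand_compress compress_in_box)
    qed
    have "(LINT x|M. \<phi> x) =
        (LINT t|density R (indicator {t. g t \<in> box 0 One}). \<phi> (expand (g t)))"
      unfolding M_def by (rule integral_distr) measurable
    also have "\<dots> = (LINT t|density R (\<lambda>t. ennreal (indicator {t. g t \<in> box 0 One} t)). \<phi> (expand (g t)))"
      by (simp add: ennreal_indicator)
    also have "\<dots> = (LINT t|R. indicator {t. g t \<in> box 0 One} t *\<^sub>R \<phi> (expand (g t)))"
      by (rule integral_density) auto
    also have "\<dots> = (LINT t|R. \<psi> (g t))"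
      by (intro Bochner_Integration.integral_cong) (auto simp: \<psi>_def)
    finally have 2: "(LINT x|M. \<phi> x) = (LINT t|R. \<psi> (g t))" .
    have "(\<lambda>n. LINT t|\<rho> (r n). \<psi> (g t)) \<longlonglongrightarrow> (LINT t|R. \<psi> (g t))"
      by (rule weak_conv_imp_integral_bdd_continuous_conv[OF real_\<rho> R weak cont]) (use B in simp)
    then show ?thesis unfolding 1 2 .
  qed
  ultimately show ?thesis using r that by blast
qed

text \<open>The total masses converge along a subsequence, so the claim follows from the one for probability
  measures by normalising.\<close>

lemma finite_measure_vague_compact:
  fixes N :: "nat \<Rightarrow> 'a::euclidean_space measure"
  assumes N: "\<And>n. sets (N n) = sets borel" "\<And>n. emeasure (N n) UNIV \<le> ennreal B"
  obtains r M where "strict_mono (r :: nat \<Rightarrow> nat)" "finite_measure M" "sets M = sets borel"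
    "\<And>\<phi> K. continuous_on UNIV \<phi> \<Longrightarrow> compact K \<Longrightarrow> (\<And>x. x \<notin> K \<Longrightarrow> \<phi> x = 0) \<Longrightarrow>
       (\<lambda>n. LINT x|N (r n). \<phi> x) \<longlonglongrightarrow> (LINT x|M. (\<phi> x :: real))"
proof -
  have space: "space (N n) = UNIV" for n
    using sets_eq_imp_space_eq[OF N(1)[of n]] by simp
  have fin: "finite_measure (N n)" for n
  proof (rule finite_measureI)
    have "emeasure (N n) UNIV < \<infinity>" using N(2)[of n] by (rule le_less_trans) simp
    then show "emeasure (N n) (space (N n)) \<noteq> \<infinity>" by (simp add: space)
  qed
  define c where "c n = measure (N n) UNIV" for n
  have c: "0 \<le> c n" "emeasure (N n) UNIV = ennreal (c n)" for n
    using finite_measure.emeasure_eq_measure[OF fin[of n], of UNIV] by (simp_all add: c_def)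
  have "c n \<in> {0..max 0 B}" for n
  proof -
    have "ennreal (c n) \<le> ennreal (max 0 B)"
      using N(2)[of n] ennreal_leI[of B "max 0 B"] c(2)[of n] by (metis max.cobounded2 order_trans)
    then show ?thesis using c(1)[of n] by simp
  qed
  then obtain c0 s where s: "strict_mono s" and c0: "c0 \<in> {0..max 0 B}" "(c \<circ> s) \<longlonglongrightarrow> c0"
    using compact_Icc[of 0 "max 0 B"] unfolding compact_def by metis
  \<comment> \<open>A zero measure cannot be normalised; any probability measure will do, as it is multiplied by the mass 0.\<close>
  define P where "P n = (if c n = 0 then return borel 0 else density (N n) (\<lambda>_. ennreal (1 / c n)))" for n
  have P_sets: "sets (P n) = sets borel" for n
    by (simp add: P_def N)
  have P: "prob_space (P n)" for n
  proof (cases "c n = 0")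
    case True
    then show ?thesis by (simp add: P_def prob_space_return)
  next
    case False
    then have "c n > 0" using c(1)[of n] by simp
    then have "emeasure (P n) (space (P n)) = 1"
      using c(2)[of n] N(1)[of n]
      by (simp add: P_def emeasure_density_const space flip: ennreal_mult)
    then show ?thesis by (rule prob_spaceI)
  qed
  have int_N: "(LINT x|N n. \<phi> x) = c n * (LINT x|P n. \<phi> x)"
    if [measurable]: "\<phi> \<in> borel_measurable borel" for n and \<phi> :: "'a \<Rightarrow> real"
  proof (cases "c n = 0")
    case True
    then have "emeasure (N n) (space (N n)) = 0" using c(2)[of n] by (simp add: space)
    then have "AE x in N n. \<phi> x = 0"
      by (intro AE_I[where N = "space (N n)"]) auto
    then show ?thesis using True integral_eq_zero_AE by force
  next
    case False
    have \<phi>: "\<phi> \<in> borel_measurable (N n)"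
      unfolding measurable_cong_sets[OF N(1) refl] by measurable
    have "(LINT x|P n. \<phi> x) = (LINT x|N n. (1 / c n) *\<^sub>R \<phi> x)"
      unfolding P_def if_not_P[OF False] by (rule integral_density) (use c(1)[of n] \<phi> in auto)
    then show ?thesis using False by simp
  qed
  obtain r M where r: "strict_mono r" and M: "finite_measure M" "sets M = sets borel"
    and conv: "\<And>\<phi> K. continuous_on UNIV \<phi> \<Longrightarrow> compact K \<Longrightarrow> (\<And>x. x \<notin> K \<Longrightarrow> \<phi> x = 0) \<Longrightarrow>
       (\<lambda>n. LINT x|P (s (r n)). \<phi> x) \<longlonglongrightarrow> (LINT x|M. (\<phi> x :: real))"
    using prob_space_vague_compact[of "\<lambda>n. P (s n)", OF P P_sets] by blast
  define M' where "M' = density M (\<lambda>_. ennreal c0)"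
  have "emeasure M' (space M') = ennreal c0 * emeasure M (space M)"
    by (simp add: M'_def emeasure_density nn_integral_cmult)
  also have "\<dots> \<noteq> \<infinity>"
    using finite_measure.emeasure_finite[OF M(1)] by (simp add: ennreal_mult_eq_top_iff)
  finally have "finite_measure M'" by (rule finite_measureI)
  moreover have "sets M' = sets borel" by (simp add: M'_def M)
  moreover have "(\<lambda>n. LINT x|N ((s \<circ> r) n). \<phi> x) \<longlonglongrightarrow> (LINT x|M'. (\<phi> x :: real))"
    if \<phi>: "continuous_on UNIV \<phi>" "compact K" "\<And>x. x \<notin> K \<Longrightarrow> \<phi> x = 0" for \<phi> K
  proof -
    have [measurable]: "\<phi> \<in> borel_measurable borel"
      by (rule borel_measurable_continuous_onI[OF \<phi>(1)])
    have "\<phi> \<in> borel_measurable M"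
      unfolding measurable_cong_sets[OF M(2) refl] by measurable
    then have "(LINT x|M'. \<phi> x) = (LINT x|M. c0 *\<^sub>R \<phi> x)"
      unfolding M'_def by (intro integral_density) (use c0(1) in auto)
    then have "(LINT x|M'. \<phi> x) = c0 * (LINT x|M. \<phi> x)" by simp
    moreover have "(\<lambda>n. c (s (r n)) * (LINT x|P (s (r n)). \<phi> x)) \<longlonglongrightarrow> c0 * (LINT x|M. \<phi> x)"
      using LIMSEQ_subseq_LIMSEQ[OF c0(2) r] conv[OF \<phi>] by (intro tendsto_mult) (simp_all add: o_def)
    ultimately show ?thesis by (simp add: int_N)
  qed
  moreover have "strict_mono (s \<circ> r)" using s r by (rule strict_mono_o)
  ultimately show ?thesis using that by blast
qed

section \<open>Finite perimeter from a linear bound on translation differences\<close>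

lemma integral_lborel_translate:
  fixes f :: "'a::euclidean_space \<Rightarrow> real"
  assumes [measurable]: "f \<in> borel_measurable borel"
  shows "(LINT x|lborel. f (x + h)) = (LINT x|lborel. f x)"
proof -
  have "(LINT x|lborel. f x) = (LINT x|distr lborel borel ((+) h). f x)"
    by (simp add: lborel_distr_plus)
  also have "\<dots> = (LINT x|lborel. f (h + x))"
    by (rule integral_distr) auto
  finally show ?thesis by (simp add: add.commute)
qed

context
  fixes \<phi> :: "real^'d \<Rightarrow> real" and k :: 'd
  assumes \<phi>: "test_function \<phi>"
begin

lemma test_function_continuous: "continuous_on UNIV \<phi>"
proof -
  have "\<phi> differentiable (at x)" for x
    using \<phi>[unfolded test_function_def] by (metis foldr_Nil id_apply)
  then show ?thesis
    by (simp add: continuous_at_imp_continuous_on differentiable_imp_continuous_within)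
qed

lemma test_function_partial_continuous: "continuous_on UNIV (partial_deriv k \<phi>)"
proof -
  have "foldr partial_deriv [k] \<phi> differentiable (at x)" for x
    using \<phi>[unfolded test_function_def] by blast
  then show ?thesis
    by (simp add: continuous_at_imp_continuous_on differentiable_imp_continuous_within)
qed

lemma test_function_has_derivative_line:
  "((\<lambda>t. \<phi> (x + t *\<^sub>R axis k 1)) has_real_derivative partial_deriv k \<phi> (x + t *\<^sub>R axis k 1)) (at t)"
proof -
  let ?y = "x + t *\<^sub>R axis k 1"
  have "\<phi> differentiable (at ?y)"
    using \<phi>[unfolded test_function_def] by (metis foldr_Nil id_apply)
  then have "\<phi> differentiable (at (?y + 0 *\<^sub>R axis k 1))" by simp
  then have "(\<phi> \<circ> (\<lambda>s. ?y + s *\<^sub>R axis k 1)) differentiable (at 0)"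
    by (intro differentiable_chain_at derivative_intros) auto
  then have "(\<lambda>s. \<phi> (?y + s *\<^sub>R axis k 1)) differentiable (at 0)" by (simp add: o_def)
  then have "((\<lambda>s. \<phi> (?y + s *\<^sub>R axis k 1)) has_real_derivative partial_deriv k \<phi> ?y) (at 0)"
    unfolding partial_deriv_def by (simp add: DERIV_deriv_iff_real_differentiable)
  then have "((\<lambda>s. \<phi> (x + (s + t) *\<^sub>R axis k 1)) has_real_derivative partial_deriv k \<phi> ?y) (at 0)"
    by (simp add: algebra_simps)
  then show ?thesis
    using DERIV_shift[of "\<lambda>s. \<phi> (x + s *\<^sub>R axis k 1)" _ 0 t] by simp
qed

lemma test_function_support:
  obtains R where "R \<ge> 0" "\<And>x. norm x > R \<Longrightarrow> \<phi> x = 0"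
proof -
  have "compact (closure {x. \<phi> x \<noteq> 0})" using \<phi> by (simp add: test_function_def)
  then have "bounded {x. \<phi> x \<noteq> 0}"
    using bounded_subset[OF compact_imp_bounded closure_subset] by blast
  then obtain R where "\<And>x. \<phi> x \<noteq> 0 \<Longrightarrow> norm x \<le> R" unfolding bounded_iff by blast
  then have "\<And>x. norm x > max 0 R \<Longrightarrow> \<phi> x = 0" by force
  then show ?thesis by (intro that[of "max 0 R"]) auto
qed

text \<open>A discrete integration by parts moves the difference quotient to the test function, where
  dominated convergence applies.\<close>

lemma difference_quotient_tendsto:
  fixes A :: "(real^'d) set"
  assumes A[measurable]: "A \<in> sets borel"
  defines "e \<equiv> \<lambda>n. (1 / real (Suc n)) *\<^sub>R axis k (1::real)"
  shows "(\<lambda>n. LINT x|lborel. \<phi> x * (real (Suc n) * (indicator A (x + e n) - indicator A x)))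
           \<longlonglongrightarrow> - (LINT x:A|lebesgue. partial_deriv k \<phi> x)"
proof -
  let ?g = "partial_deriv k \<phi>" and ?I = "indicator A :: real^'d \<Rightarrow> real"
  note [measurable] = borel_measurable_continuous_onI[OF test_function_continuous]
    borel_measurable_continuous_onI[OF test_function_partial_continuous]
  have [measurable]: "?I \<in> borel_measurable borel" by simp
  obtain R where R: "R \<ge> 0" "\<And>x. norm x > R \<Longrightarrow> \<phi> x = 0"
    using test_function_support by blast
  have e: "norm (e n) \<le> 1" for n by (simp add: e_def)
  have "bounded (?g ` cball 0 (R + 2))"
    by (intro compact_imp_bounded compact_continuous_image
        continuous_on_subset[OF test_function_partial_continuous]) auto
  then obtain B where "\<forall>y \<in> ?g ` cball 0 (R + 2). norm y \<le> B"
    unfolding bounded_iff by blast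
  then have B: "\<bar>?g x\<bar> \<le> B" if "norm x \<le> R + 2" for x
    using that by simp
  have B0: "B \<ge> 0" using B[of 0] R(1) by simp
  define q where "q n x = real (Suc n) * (\<phi> (x - e n) - \<phi> x)" for n x
  have q_bound: "\<bar>q n x\<bar> \<le> B * indicator (cball 0 (R + 1)) x" for n x
  proof (cases "norm x \<le> R + 1")
    case True
    let ?h = "1 / real (Suc n)"
    have "\<exists>z>-?h. z < 0 \<and> \<phi> (x + 0 *\<^sub>R axis k 1) - \<phi> (x + (-?h) *\<^sub>R axis k 1)
        = (0 - (-?h)) * ?g (x + z *\<^sub>R axis k 1)"
      by (rule MVT2) (auto intro: test_function_has_derivative_line)
    then obtain z where z: "-?h < z" "z < 0"
      "\<phi> x - \<phi> (x - e n) = ?h * ?g (x + z *\<^sub>R axis k 1)" by (auto simp: e_def)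
    have "?h \<le> 1" by simp
    then have "\<bar>z\<bar> \<le> 1" using z by linarith
    moreover have "norm (x + z *\<^sub>R axis k 1) \<le> norm x + \<bar>z\<bar>"
      using norm_triangle_ineq[of x "z *\<^sub>R axis k 1"] by simp
    ultimately have "\<bar>?g (x + z *\<^sub>R axis k 1)\<bar> \<le> B" using True by (intro B) linarith
    moreover have "q n x = - ?g (x + z *\<^sub>R axis k 1)"
    proof -
      have "q n x = - (real (Suc n) * (\<phi> x - \<phi> (x - e n)))" by (simp add: q_def algebra_simps)
      then show ?thesis unfolding z(3) by simp
    qed
    ultimately show ?thesis using True by simp
  next
    case False
    have "norm x \<le> norm (x - e n) + norm (e n)" using norm_triangle_ineq[of "x - e n" "e n"] by simp
    then have "norm (x - e n) > R" "norm x > R" using False e[of n] by linarith+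
    then show ?thesis using R False by (simp add: q_def)
  qed
  have q_lim: "(\<lambda>n. q n x) \<longlonglongrightarrow> - ?g x" for x
  proof -
    let ?G = "\<lambda>t. \<phi> (x + t *\<^sub>R axis k 1)" and ?t = "\<lambda>n. - (1 / real (Suc n))"
    have "(?G has_real_derivative ?g x) (at 0)"
      using test_function_has_derivative_line[of x 0] by simp
    then have "((\<lambda>t. (?G t - ?G 0) / t) \<longlongrightarrow> ?g x) (at 0)"
      by (simp add: DERIV_def)
    moreover have "filterlim ?t (at 0) sequentially"
    proof -
      have "?t \<longlonglongrightarrow> - 0" by (intro tendsto_minus LIMSEQ_Suc lim_const_over_n)
      then show ?thesis by (simp add: filterlim_at)
    qed
    ultimately have "(\<lambda>n. (?G (?t n) - ?G 0) / ?t n) \<longlonglongrightarrow> ?g x"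
      by (rule filterlim_compose)
    then have "(\<lambda>n. - ((?G (?t n) - ?G 0) / ?t n)) \<longlonglongrightarrow> - ?g x"
      by (rule tendsto_minus)
    moreover have "- ((?G (?t n) - ?G 0) / ?t n) = q n x" for n
      by (simp add: q_def e_def mult.commute)
    ultimately show ?thesis by simp
  qed
  have parts: "(LINT x|lborel. \<phi> x * (real (Suc n) * (?I (x + e n) - ?I x)))
      = (LINT x|lborel. ?I x * q n x)" for n
  proof -
    have int: "integrable lborel (\<lambda>x. \<phi> x * f x)"
      if [measurable]: "f \<in> borel_measurable borel" and f: "\<And>x. \<bar>f x\<bar> \<le> 1" for f
    proof -
      have "bounded (\<phi> ` cball 0 R)"
        by (intro compact_imp_bounded compact_continuous_image
            continuous_on_subset[OF test_function_continuous]) auto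
      then obtain C where "\<forall>y \<in> \<phi> ` cball 0 R. norm y \<le> C"
        unfolding bounded_iff by blast
      then have C: "\<bar>\<phi> x\<bar> \<le> C" if "x \<in> cball 0 R" for x
        using that by simp
      show ?thesis
      proof (rule integrableI_bounded_set[where A = "cball 0 R" and B = C])
        show "emeasure lborel (cball (0::real^'d) R) < \<infinity>" by (rule emeasure_bounded_finite) simp
        show "AE x\<in>cball 0 R in lborel. norm (\<phi> x * f x) \<le> C"
        proof (intro always_eventually allI impI)
          fix x :: "real^'d" assume x: "x \<in> cball 0 R"
          have "0 \<le> C" using C[OF x] by linarith
          then show "norm (\<phi> x * f x) \<le> C"
            using mult_mono[OF C[OF x] f[of x]] by (simp add: abs_mult)
        qed
      qed (use R in \<open>auto\<close>)
    qed
    have I1: "integrable lborel (\<lambda>x. \<phi> x * ?I (x + e n))" "integrable lborel (\<lambda>x. \<phi> x * ?I x)"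
      by (rule int; simp add: indicator_def)+
    have "integrable lborel (\<lambda>x. \<phi> (x + (- e n)) * ?I x)"
    proof -
      have "integrable (distr lborel borel ((+) (e n))) (\<lambda>x. \<phi> (x - e n) * ?I x)"
        by (subst integrable_distr_eq) (use I1(1) in \<open>auto simp: add.commute\<close>)
      then show ?thesis by (simp add: lborel_distr_plus)
    qed
    then have I2: "integrable lborel (\<lambda>x. \<phi> (x - e n) * ?I x)" by simp
    have "(LINT x|lborel. \<phi> x * (real (Suc n) * (?I (x + e n) - ?I x)))
        = (LINT x|lborel. real (Suc n) * (\<phi> x * ?I (x + e n) - \<phi> x * ?I x))"
      by (intro Bochner_Integration.integral_cong) (auto simp: algebra_simps)
    also have "\<dots> = real (Suc n) * ((LINT x|lborel. \<phi> x * ?I (x + e n)) - (LINT x|lborel. \<phi> x * ?I x))"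
      by (simp only: integral_mult_right_zero Bochner_Integration.integral_diff[OF I1])
    also have "(LINT x|lborel. \<phi> x * ?I (x + e n)) = (LINT x|lborel. \<phi> (x - e n) * ?I x)"
      using integral_lborel_translate[of "\<lambda>x. \<phi> (x - e n) * ?I x" "e n"] by simp
    also have "real (Suc n) * ((LINT x|lborel. \<phi> (x - e n) * ?I x) - (LINT x|lborel. \<phi> x * ?I x))
        = (LINT x|lborel. real (Suc n) * (\<phi> (x - e n) * ?I x - \<phi> x * ?I x))"
      by (simp only: integral_mult_right_zero Bochner_Integration.integral_diff[OF I2 I1(2)])
    also have "\<dots> = (LINT x|lborel. ?I x * q n x)"
      by (intro Bochner_Integration.integral_cong) (auto simp: q_def algebra_simps)
    finally show ?thesis .
  qed
  have "(\<lambda>n. LINT x|lborel. ?I x * q n x) \<longlonglongrightarrow> (LINT x|lborel. ?I x * - ?g x)"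
  proof (rule integral_dominated_convergence[where w = "\<lambda>x. B * indicator (cball 0 (R + 1)) x"])
    show "(\<lambda>x. ?I x * - ?g x) \<in> borel_measurable lborel"
      "(\<lambda>x. ?I x * q n x) \<in> borel_measurable lborel" for n
      unfolding q_def by measurable
    have "emeasure lborel (cball (0::real^'d) (R + 1)) < \<infinity>" by (rule emeasure_bounded_finite) simp
    then show "integrable lborel (\<lambda>x. B * indicator (cball (0::real^'d) (R + 1)) x)"
      by (intro integrable_mult_right integrable_real_indicator) auto
    show "AE x in lborel. (\<lambda>n. ?I x * q n x) \<longlonglongrightarrow> ?I x * - ?g x"
      by (intro always_eventually allI tendsto_intros q_lim)
    show "AE x in lborel. norm (?I x * q n x) \<le> B * indicator (cball 0 (R + 1)) x" for n
    proof (intro always_eventually allI)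
      fix x
      have "norm (?I x * q n x) \<le> \<bar>q n x\<bar>" by (simp add: indicator_def)
      then show "norm (?I x * q n x) \<le> B * indicator (cball 0 (R + 1)) x"
        using q_bound[of n x] by linarith
    qed
  qed
  moreover have "(LINT x|lborel. ?I x * - ?g x) = - (LINT x:A|lebesgue. ?g x)"
  proof -
    have "(LINT x:A|lebesgue. ?g x) = (LINT x|lborel. ?I x * ?g x)"
      unfolding set_lebesgue_integral_def by (simp add: integral_completion)
    then show ?thesis by simp
  qed
  ultimately show ?thesis unfolding parts by simp
qed

end

text \<open>The difference quotients of the indicator in direction \<open>k\<close> have \<open>L\<^sup>1\<close> norm at most \<open>K\<close>. Their
  positive and negative parts are densities of measures of mass at most \<open>K\<close>, and the vague limits
  \<open>\<mu>\<close> and \<open>\<nu>\<close> of these form the distributional derivative.\<close>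

theorem finite_perimeter_if_translation_gap_linear:
  fixes A :: "(real^'d) set"
  assumes A[measurable]: "A \<in> sets borel" and K: "K \<ge> 0"
    and gap: "\<And>h. translation_gap (indicator A) h \<le> ennreal (K * norm h)"
  shows "finite_perimeter A"
proof -
  let ?I = "indicator A :: real^'d \<Rightarrow> real"
  have [measurable]: "?I \<in> borel_measurable borel" by simp
  have "\<exists>\<mu> \<nu>. finite_measure \<mu> \<and> sets \<mu> = sets borel \<and> finite_measure \<nu> \<and> sets \<nu> = sets borel \<and>
      (\<forall>\<phi>. test_function \<phi> \<longrightarrow> (LINT x:A|lebesgue. partial_deriv k \<phi> x)
          = - ((LINT x|\<mu>. \<phi> x) - (LINT x|\<nu>. \<phi> x)))" for k :: 'd
  proof -
    define e where "e n = (1 / real (Suc n)) *\<^sub>R axis k (1::real)" for n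
    define f where "f n x = real (Suc n) * (?I (x + e n) - ?I x)" for n x
    have [measurable]: "f n \<in> borel_measurable borel" for n unfolding f_def by measurable
    define P where "P n = density lborel (\<lambda>x. ennreal (max 0 (f n x)))" for n
    define Q where "Q n = density lborel (\<lambda>x. ennreal (max 0 (- f n x)))" for n
    have mass: "(\<integral>\<^sup>+x. ennreal \<bar>f n x\<bar> \<partial>lborel) \<le> ennreal K" for n
    proof -
      have "(\<integral>\<^sup>+x. ennreal \<bar>f n x\<bar> \<partial>lborel) = ennreal (real (Suc n)) * translation_gap ?I (e n)"
        unfolding f_def translation_gap_def abs_mult
        by (subst nn_integral_cmult[symmetric]) (simp_all add: ennreal_mult)
      also have "\<dots> \<le> ennreal (real (Suc n)) * ennreal (K * norm (e n))"
        by (intro mult_left_mono gap) simp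
      also have "\<dots> = ennreal (real (Suc n) * (K * norm (e n)))"
        using K by (intro ennreal_mult[symmetric]) auto
      also have "real (Suc n) * (K * norm (e n)) = K"
        by (simp add: e_def)
      finally show ?thesis .
    qed
    have PQ: "sets (P n) = sets borel" "sets (Q n) = sets borel"
      "emeasure (P n) UNIV \<le> ennreal K" "emeasure (Q n) UNIV \<le> ennreal K" for n
    proof -
      have "emeasure (P n) UNIV \<le> (\<integral>\<^sup>+x. ennreal \<bar>f n x\<bar> \<partial>lborel)"
        "emeasure (Q n) UNIV \<le> (\<integral>\<^sup>+x. ennreal \<bar>f n x\<bar> \<partial>lborel)"
        unfolding P_def Q_def
        by (auto simp: emeasure_density intro!: nn_integral_mono ennreal_leI)
      then show "emeasure (P n) UNIV \<le> ennreal K" "emeasure (Q n) UNIV \<le> ennreal K"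
        using mass[of n] by (auto intro: order_trans)
    qed (simp_all add: P_def Q_def)
    obtain r1 \<mu> where r1: "strict_mono r1" and \<mu>: "finite_measure \<mu>" "sets \<mu> = sets borel"
      "\<And>\<phi> K. continuous_on UNIV \<phi> \<Longrightarrow> compact K \<Longrightarrow> (\<And>x. x \<notin> K \<Longrightarrow> \<phi> x = 0) \<Longrightarrow>
       (\<lambda>n. LINT x|P (r1 n). \<phi> x) \<longlonglongrightarrow> (LINT x|\<mu>. (\<phi> x :: real))"
      using finite_measure_vague_compact[of P, OF PQ(1,3)] by blast
    obtain r2 \<nu> where r2: "strict_mono r2" and \<nu>: "finite_measure \<nu>" "sets \<nu> = sets borel"
      "\<And>\<phi> K. continuous_on UNIV \<phi> \<Longrightarrow> compact K \<Longrightarrow> (\<And>x. x \<notin> K \<Longrightarrow> \<phi> x = 0) \<Longrightarrow>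
       (\<lambda>n. LINT x|Q (r1 (r2 n)). \<phi> x) \<longlonglongrightarrow> (LINT x|\<nu>. (\<phi> x :: real))"
      using finite_measure_vague_compact[of "\<lambda>n. Q (r1 n)", OF PQ(2,4)] by blast
    have "(LINT x:A|lebesgue. partial_deriv k \<phi> x) = - ((LINT x|\<mu>. \<phi> x) - (LINT x|\<nu>. \<phi> x))"
      if \<phi>: "test_function \<phi>" for \<phi>
    proof -
      let ?S = "closure {x. \<phi> x \<noteq> 0}"
      have cont: "continuous_on UNIV \<phi>" by (rule test_function_continuous[OF \<phi>])
      have S: "compact ?S" "x \<notin> ?S \<Longrightarrow> \<phi> x = 0" for x
        using \<phi> closure_subset[of "{x. \<phi> x \<noteq> 0}"] by (auto simp: test_function_def)
      note [measurable] = borel_measurable_continuous_onI[OF cont]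
      have diff: "(LINT x|P n. \<phi> x) - (LINT x|Q n. \<phi> x)
          = (LINT x|lborel. \<phi> x * (real (Suc n) * (?I (x + e n) - ?I x)))" for n
      proof -
        have "bounded (\<phi> ` ?S)"
          by (intro compact_imp_bounded compact_continuous_image continuous_on_subset[OF cont] S) auto
        then obtain C where C: "\<And>x. x \<in> ?S \<Longrightarrow> \<bar>\<phi> x\<bar> \<le> C" by (auto simp: bounded_iff)
        have int: "integrable lborel (\<lambda>x. g x * \<phi> x)"
          if [measurable]: "g \<in> borel_measurable borel" and g: "\<And>x. \<bar>g x\<bar> \<le> real (Suc n)" for g
        proof (rule integrableI_bounded_set[where A = ?S and B = "real (Suc n) * C"])
          show "emeasure lborel ?S < \<infinity>" by (rule emeasure_bounded_finite[OF compact_imp_bounded[OF S(1)]])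
          show "AE x\<in>?S in lborel. norm (g x * \<phi> x) \<le> real (Suc n) * C"
          proof (intro always_eventually allI impI)
            fix x assume x: "x \<in> ?S"
            show "norm (g x * \<phi> x) \<le> real (Suc n) * C"
              using mult_mono[OF g[of x] C[OF x]] by (simp add: abs_mult)
          qed
          show "AE x in lborel. x \<notin> ?S \<longrightarrow> g x * \<phi> x = 0"
          proof (intro always_eventually allI impI)
            fix x assume "x \<notin> ?S"
            from S(2)[OF this] show "g x * \<phi> x = 0" by (simp only: mult_zero_right)
          qed
        qed simp_all
        have fb: "\<bar>f n x\<bar> \<le> real (Suc n)" for x
          by (auto simp: f_def indicator_def)
        have b: "\<bar>max 0 (f n x)\<bar> \<le> real (Suc n)" "\<bar>max 0 (- f n x)\<bar> \<le> real (Suc n)" for x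
          using fb[of x] by linarith+
        have 1: "integrable lborel (\<lambda>x. max 0 (f n x) * \<phi> x)"
          by (rule int[OF _ b(1)]) measurable
        have 2: "integrable lborel (\<lambda>x. max 0 (- f n x) * \<phi> x)"
          by (rule int[OF _ b(2)]) measurable
        have "(LINT x|P n. \<phi> x) = (LINT x|lborel. max 0 (f n x) * \<phi> x)"
          "(LINT x|Q n. \<phi> x) = (LINT x|lborel. max 0 (- f n x) * \<phi> x)"
          unfolding P_def Q_def by (subst integral_density; simp)+
        then have "(LINT x|P n. \<phi> x) - (LINT x|Q n. \<phi> x)
            = (LINT x|lborel. max 0 (f n x) * \<phi> x - max 0 (- f n x) * \<phi> x)"
          by (simp only: Bochner_Integration.integral_diff[OF 1 2])
        also have "\<dots> = (LINT x|lborel. \<phi> x * f n x)"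
          by (intro Bochner_Integration.integral_cong) (auto simp: max_def algebra_simps)
        finally show ?thesis unfolding f_def .
      qed
      have "(\<lambda>n. LINT x|P (r1 (r2 n)). \<phi> x) \<longlonglongrightarrow> (LINT x|\<mu>. \<phi> x)"
        using LIMSEQ_subseq_LIMSEQ[OF \<mu>(3)[OF cont S] r2] by (simp add: o_def)
      then have "(\<lambda>n. (LINT x|P (r1 (r2 n)). \<phi> x) - (LINT x|Q (r1 (r2 n)). \<phi> x))
          \<longlonglongrightarrow> (LINT x|\<mu>. \<phi> x) - (LINT x|\<nu>. \<phi> x)"
        by (intro tendsto_diff \<nu>(3)[OF cont S])
      moreover have "(\<lambda>n. (LINT x|P (r1 (r2 n)). \<phi> x) - (LINT x|Q (r1 (r2 n)). \<phi> x))
          \<longlonglongrightarrow> - (LINT x:A|lebesgue. partial_deriv k \<phi> x)"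
        unfolding diff
        using LIMSEQ_subseq_LIMSEQ[OF difference_quotient_tendsto[OF \<phi> A, of k] strict_mono_o[OF r1 r2]]
        by (simp only: o_def e_def)
      ultimately show ?thesis using LIMSEQ_unique by fastforce
    qed
    then show ?thesis using \<mu>(1,2) \<nu>(1,2) by blast
  qed
  then obtain \<mu> \<nu> :: "'d \<Rightarrow> (real^'d) measure" where
    "\<And>k. finite_measure (\<mu> k) \<and> sets (\<mu> k) = sets borel \<and> finite_measure (\<nu> k) \<and> sets (\<nu> k) = sets borel \<and>
      (\<forall>\<phi>. test_function \<phi> \<longrightarrow> (LINT x:A|lebesgue. partial_deriv k \<phi> x)
          = - ((LINT x|\<mu> k. \<phi> x) - (LINT x|\<nu> k. \<phi> x)))"
    by metis
  moreover have "A \<in> sets lebesgue" by simp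
  ultimately show ?thesis
    unfolding finite_perimeter_def by (intro conjI exI[of _ \<mu>] exI[of _ \<nu>]) blast+
qed

section \<open>The energy controls translation differences\<close>

text \<open>The integral with respect to counting measure can be interchanged with Lebesgue integrals, which
  makes it the convenient form of the sum in the energy.\<close>

lemma nn_integral_count_space_le_infsum:
  fixes f :: "'i \<Rightarrow> ennreal"
  assumes "countable P"
  shows "(\<integral>\<^sup>+p. f p \<partial>count_space P) \<le> infsum f P"
proof -
  have le: "sum f F \<le> infsum f P" if "finite F" "F \<subseteq> P" for F
    using that by (subst nonneg_infsum_complete) (auto intro!: SUP_upper)
  show ?thesis
  proof (cases "finite P")
    case True
    then show ?thesis using le[of P] by (simp add: nn_integral_count_space_finite)
  next
    case False
    let ?g = "from_nat_into P"
    have bij: "bij_betw ?g UNIV P" using assms False by (rule bij_betw_from_nat_into)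
    then have inj: "inj ?g" and ran: "range ?g = P" by (auto simp: bij_betw_def)
    have "(\<integral>\<^sup>+p. f p \<partial>count_space P) = (\<Sum>n. f (?g n))"
      by (simp add: nn_integral_bij_count_space[OF bij, symmetric] nn_integral_count_space_nat)
    also have "\<dots> = (SUP n. \<Sum>i<n. f (?g i))" by (rule suminf_eq_SUP)
    also have "\<dots> \<le> infsum f P"
    proof (rule SUP_least)
      fix n
      have "(\<Sum>i<n. f (?g i)) = sum f (?g ` {..<n})"
        using inj by (subst sum.reindex) (auto simp: inj_on_def o_def)
      also have "\<dots> \<le> infsum f P" using ran by (intro le) auto
      finally show "(\<Sum>i<n. f (?g i)) \<le> infsum f P" .
    qed
    finally show ?thesis .
  qed
qed

lemma AE_lborel_not_equidistant:
  fixes a b :: "'a::euclidean_space"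
  assumes "a \<noteq> b"
  shows "AE x in lborel. norm (x - a) \<noteq> norm (x - b)"
proof -
  let ?H = "{x. (2 *\<^sub>R (b - a)) \<bullet> x = b \<bullet> b - a \<bullet> a}"
  have "negligible ?H" using assms by (intro negligible_hyperplane) simp
  moreover have "?H \<in> sets borel" by measurable
  ultimately have "?H \<in> null_sets lborel"
    by (simp add: negligible_iff_null_sets null_sets_completion_iff)
  then show ?thesis
  proof (rule AE_I')
    have "x \<in> ?H" if "norm (x - a) = norm (x - b)" for x
    proof -
      have "(x - a) \<bullet> (x - a) = (x - b) \<bullet> (x - b)"
        using that by (simp add: norm_eq)
      then show ?thesis
        by (simp add: inner_diff_left inner_diff_right inner_commute algebra_simps)
    qed
    then show "{x \<in> space lborel. \<not> norm (x - a) \<noteq> norm (x - b)} \<subseteq> ?H" by auto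
  qed
qed

context
  fixes L :: "(real^'d) set"
  assumes ne: "L \<noteq> {}" and lf: "locally_finite L" and per: "unit_periodic L"
begin

lemma lattice_countable: "countable L"
proof -
  have "L = (\<Union>n::nat. L \<inter> cball 0 (real n))"
    using real_arch_simple by fastforce
  moreover have "finite (L \<inter> cball 0 (real n))" for n
    using lf by (simp add: locally_finite_def)
  ultimately show ?thesis
    by (metis countable_UN countable_finite countableI_type)
qed

lemma lattice_translate_axis: "x + of_int n *\<^sub>R axis k 1 \<in> L" if "x \<in> L"
proof -
  have im: "(\<lambda>x. x + axis k 1) ` L = L" using per by (simp add: unit_periodic_def)
  have plus: "y + axis k 1 \<in> L" if "y \<in> L" for y using im that by blast
  have minus: "y - axis k 1 \<in> L" if "y \<in> L" for y
  proof -
    have "y \<in> (\<lambda>x. x + axis k 1) ` L" using im that by simp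
    then show ?thesis by auto
  qed
  show ?thesis
  proof (induction n rule: int_induct[where k = 0])
    case base
    then show ?case using that by simp
  next
    case (step1 i)
    have "x + of_int (i + 1) *\<^sub>R axis k 1 = (x + of_int i *\<^sub>R axis k 1) + axis k 1"
      by (simp add: algebra_simps)
    then show ?case using plus step1 by metis
  next
    case (step2 i)
    have "x + of_int (i - 1) *\<^sub>R axis k 1 = (x + of_int i *\<^sub>R axis k 1) - axis k 1"
      by (simp add: algebra_simps)
    then show ?case using minus step2 by metis
  qed
qed

text \<open>Moving a lattice point by the integer parts of the coordinates of its offset from \<open>x\<close> leaves an
  offset with coordinates in \<open>[0, 1)\<close>. This bounds the Voronoi cells.\<close>

lemma lattice_point_near: "\<exists>i\<in>L. norm (x - i) \<le> real CARD('d)"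
proof -
  obtain i where i: "i \<in> L" using ne by blast
  let ?z = "\<lambda>k. \<lfloor>x $ k - i $ k\<rfloor>"
  have "i + (\<Sum>k\<in>S. of_int (?z k) *\<^sub>R axis k 1) \<in> L" if "finite S" for S
    using that
  proof (induction S rule: finite_induct)
    case empty
    then show ?case using i by simp
  next
    case (insert k S)
    then show ?case
      using lattice_translate_axis[OF insert.IH, of "?z k" k] by (simp add: add_ac)
  qed
  then have j: "i + (\<Sum>k\<in>UNIV. of_int (?z k) *\<^sub>R axis k 1) \<in> L" (is "?j \<in> L") by simp
  have "\<bar>(x - ?j) $ k\<bar> \<le> 1" for k
  proof -
    have "(\<Sum>l\<in>UNIV. of_int (?z l) *\<^sub>R axis l (1::real)) $ k = of_int (?z k)"
      by (simp add: axis_def if_distrib cong: if_cong)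
    then show ?thesis by simp linarith
  qed
  then have "(\<Sum>k\<in>UNIV. \<bar>(x - ?j) $ k\<bar>) \<le> (\<Sum>k\<in>(UNIV::'d set). 1)" by (rule sum_mono)
  then have "norm (x - ?j) \<le> real CARD('d)" using norm_le_l1_cart[of "x - ?j"] by simp
  then show ?thesis using j by blast
qed

lemma voronoi_cell_subset_cball:
  assumes "i \<in> L"
  shows "voronoi_cell L i \<subseteq> cball i CARD('d)"
proof
  fix x assume x: "x \<in> voronoi_cell L i"
  obtain j where j: "j \<in> L" "norm (x - j) \<le> real CARD('d)" using lattice_point_near by blast
  have "norm (x - i) \<le> norm (x - j)"
    using x j(1) by (cases "j = i") (auto simp: voronoi_cell_def intro: less_imp_le)
  then show "x \<in> cball i CARD('d)" using j(2) by (simp add: dist_norm norm_minus_commute)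
qed

lemma nearest_lattice_point: "\<exists>i\<in>L. \<forall>j\<in>L. norm (x - i) \<le> norm (x - j)"
proof -
  let ?F = "L \<inter> cball x CARD('d)"
  have "finite ?F" using lf by (simp add: locally_finite_def)
  moreover have "?F \<noteq> {}"
    using lattice_point_near[of x] by (auto simp: dist_norm)
  ultimately obtain i where i: "i \<in> ?F" "\<And>j. j \<in> ?F \<Longrightarrow> norm (x - i) \<le> norm (x - j)"
    using arg_min_if_finite[of ?F "\<lambda>j. norm (x - j)"] by (metis linorder_not_less)
  have "norm (x - i) \<le> norm (x - j)" if "j \<in> L" for j
  proof (cases "j \<in> ?F")
    case False
    then show ?thesis using i(1) that by (simp add: dist_norm)
  qed (rule i)
  then show ?thesis using i(1) by blast
qed

lemma scaled_voronoi_cell_iff: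
  assumes "\<epsilon> > 0"
  shows "x \<in> scaleR \<epsilon> ` voronoi_cell L i \<longleftrightarrow> (1 / \<epsilon>) *\<^sub>R x \<in> voronoi_cell L i"
proof
  assume "(1 / \<epsilon>) *\<^sub>R x \<in> voronoi_cell L i"
  moreover have "x = \<epsilon> *\<^sub>R ((1 / \<epsilon>) *\<^sub>R x)" using assms by simp
  ultimately show "x \<in> scaleR \<epsilon> ` voronoi_cell L i" by (rule rev_image_eqI)
qed (use assms in auto)

text \<open>A nearest lattice point exists everywhere, and it is unique off the countably many hyperplanes of
  points equidistant to two lattice points.\<close>

lemma AE_in_scaled_voronoi_cell:
  assumes \<epsilon>: "\<epsilon> > 0"
  shows "AE x in lborel. \<exists>i\<in>L. x \<in> scaleR \<epsilon> ` voronoi_cell L i"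
proof -
  have "AE x in lborel. \<forall>p\<in>{p \<in> L \<times> L. fst p \<noteq> snd p}. norm (x - \<epsilon> *\<^sub>R fst p) \<noteq> norm (x - \<epsilon> *\<^sub>R snd p)"
  proof (subst AE_ball_countable)
    show "countable {p \<in> L \<times> L. fst p \<noteq> snd p}"
      by (rule countable_subset[OF _ countable_SIGMA[OF lattice_countable lattice_countable]]) auto
    show "\<forall>p\<in>{p \<in> L \<times> L. fst p \<noteq> snd p}. AE x in lborel. norm (x - \<epsilon> *\<^sub>R fst p) \<noteq> norm (x - \<epsilon> *\<^sub>R snd p)"
      using \<epsilon> by (auto intro!: AE_lborel_not_equidistant)
  qed
  then show ?thesis
  proof eventually_elim
    case (elim x)
    let ?y = "(1 / \<epsilon>) *\<^sub>R x"
    obtain i where i: "i \<in> L" "\<And>j. j \<in> L \<Longrightarrow> norm (?y - i) \<le> norm (?y - j)"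
      using nearest_lattice_point by blast
    have "norm (?y - i) < norm (?y - j)" if "j \<in> L" "j \<noteq> i" for j
    proof -
      have eq: "norm (x - \<epsilon> *\<^sub>R l) = \<epsilon> * norm (?y - l)" for l
      proof -
        have "x - \<epsilon> *\<^sub>R l = \<epsilon> *\<^sub>R (?y - l)" using \<epsilon> by (simp add: scaleR_diff_right)
        then show ?thesis using \<epsilon> by simp
      qed
      have "norm (x - \<epsilon> *\<^sub>R i) \<noteq> norm (x - \<epsilon> *\<^sub>R j)" using elim i(1) that by auto
      then show ?thesis using i(2)[OF that(1)] unfolding eq by auto
    qed
    then have "?y \<in> voronoi_cell L i" by (auto simp: voronoi_cell_def)
    then show ?case using i(1) scaled_voronoi_cell_iff[OF \<epsilon>] by blast
  qed
qed

lemma sets_scaled_voronoi_cell: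
  assumes \<epsilon>: "\<epsilon> > 0"
  shows "scaleR \<epsilon> ` voronoi_cell L i \<in> sets borel"
proof -
  have "voronoi_cell L i = (\<Inter>j\<in>L - {i}. {x. norm (x - i) < norm (x - j)})"
    by (auto simp: voronoi_cell_def)
  also have "\<dots> \<in> sets borel"
  proof (cases "L - {i} = {}")
    case False
    show ?thesis
    proof (rule sets.countable_INT'[OF countable_subset[OF Diff_subset lattice_countable] False])
      show "(\<lambda>j. {x. norm (x - i) < norm (x - j)}) ` (L - {i}) \<subseteq> sets borel"
        by (auto intro!: borel_open open_Collect_less continuous_intros)
    qed
  next
    case True
    then show ?thesis by (simp only: INT_empty) simp
  qed
  finally have [measurable]: "voronoi_cell L i \<in> sets borel" .
  have "scaleR \<epsilon> ` voronoi_cell L i = {x. (1 / \<epsilon>) *\<^sub>R x \<in> voronoi_cell L i}"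
    using scaled_voronoi_cell_iff[OF \<epsilon>] by blast
  also have "\<dots> \<in> sets borel" by measurable
  finally show ?thesis .
qed

lemma scaled_voronoi_cell_subset_cball:
  assumes \<epsilon>: "\<epsilon> > 0" and i: "i \<in> L"
  shows "scaleR \<epsilon> ` voronoi_cell L i \<subseteq> cball (\<epsilon> *\<^sub>R i) (\<epsilon> * CARD('d))"
proof (rule image_subsetI)
  fix x assume "x \<in> voronoi_cell L i"
  then have "norm (i - x) \<le> CARD('d)"
    using voronoi_cell_subset_cball[OF i] by (auto simp: dist_norm)
  moreover have "\<epsilon> *\<^sub>R i - \<epsilon> *\<^sub>R x = \<epsilon> *\<^sub>R (i - x)" by (simp add: scaleR_diff_right)
  ultimately show "\<epsilon> *\<^sub>R x \<in> cball (\<epsilon> *\<^sub>R i) (\<epsilon> * CARD('d))"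
    using \<epsilon> by (simp add: dist_norm)
qed

lemma emeasure_scaled_voronoi_cell_le:
  assumes \<epsilon>: "\<epsilon> > 0" and i: "i \<in> L"
  shows "emeasure lborel (scaleR \<epsilon> ` voronoi_cell L i)
    \<le> ennreal (unit_ball_vol CARD('d) * (\<epsilon> * CARD('d)) ^ CARD('d))"
proof -
  have "emeasure lborel (scaleR \<epsilon> ` voronoi_cell L i) \<le> emeasure lborel (cball (\<epsilon> *\<^sub>R i) (\<epsilon> * CARD('d)))"
    by (rule emeasure_mono[OF scaled_voronoi_cell_subset_cball[OF assms]]) simp
  then show ?thesis using \<epsilon> by (simp add: emeasure_cball)
qed

lemma interpolation_eq_indicator:
  assumes \<epsilon>: "\<epsilon> > 0" and w: "w \<in> scaleR \<epsilon> ` L \<rightarrow> {0, 1}"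
  shows "interpolation L \<epsilon> w = indicator {x. interpolation L \<epsilon> w x = 1}"
    and "{x. interpolation L \<epsilon> w x = 1} \<in> sets borel"
proof -
  have val: "w (\<epsilon> *\<^sub>R i) \<in> {0, 1}" if "i \<in> L" for i using w that by blast
  have "interpolation L \<epsilon> w x \<in> {0, 1}" for x
  proof (cases "\<exists>i\<in>L. x \<in> scaleR \<epsilon> ` voronoi_cell L i")
    case True
    then obtain i where "i \<in> L" "x \<in> scaleR \<epsilon> ` voronoi_cell L i" by blast
    then show ?thesis using interpolation_eq[OF \<epsilon>, of i L x w] val by simp
  next
    case False
    then show ?thesis unfolding interpolation_def if_not_P[OF False] by simp
  qed
  then show "interpolation L \<epsilon> w = indicator {x. interpolation L \<epsilon> w x = 1}"
    by (fastforce simp: indicator_def)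
  have "{x. interpolation L \<epsilon> w x = 1}
      = (\<Union>i\<in>{i\<in>L. w (\<epsilon> *\<^sub>R i) = 1}. scaleR \<epsilon> ` voronoi_cell L i)" (is "?l = ?r")
  proof (intro equalityI subsetI)
    fix x assume x: "x \<in> ?l"
    then have "\<exists>i\<in>L. x \<in> scaleR \<epsilon> ` voronoi_cell L i"
      unfolding interpolation_def by (auto split: if_splits)
    then obtain i where i: "i \<in> L" "x \<in> scaleR \<epsilon> ` voronoi_cell L i" by blast
    then have "w (\<epsilon> *\<^sub>R i) = 1" using interpolation_eq[OF \<epsilon> i, of w] x by simp
    then show "x \<in> ?r" using i by blast
  next
    fix x assume "x \<in> ?r"
    then obtain i where i: "i \<in> L" "x \<in> scaleR \<epsilon> ` voronoi_cell L i" and "w (\<epsilon> *\<^sub>R i) = 1" by blast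
    then show "x \<in> ?l" using interpolation_eq[OF \<epsilon> i, of w] by simp
  qed
  moreover have "countable {i\<in>L. w (\<epsilon> *\<^sub>R i) = 1}"
    by (rule countable_subset[OF _ lattice_countable]) auto
  ultimately show "{x. interpolation L \<epsilon> w x = 1} \<in> sets borel"
    using sets.countable_UN''[of _ "\<lambda>i. scaleR \<epsilon> ` voronoi_cell L i" borel]
      sets_scaled_voronoi_cell[OF \<epsilon>] by simp
qed

text \<open>Up to null sets, the double integral splits into integrals over pairs of cells, on which the
  integrand is constant. If the cells of \<open>i\<close> and \<open>j\<close> contain points at distance at most \<open>\<eta> / 4\<close>, then
  \<open>\<epsilon> \<bar>i - j\<bar> \<le> \<eta> / 4 + 2 d \<epsilon>\<close>, which is below \<open>\<eta> / 2\<close> as soon as \<open>\<eta> > 8 d \<epsilon>\<close>; such pairs occur in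
  the energy. The number \<open>M\<close> bounds the volume of a cell.\<close>

lemma gap_integral_le_interaction_sum:
  fixes w :: "real^'d \<Rightarrow> real"
  assumes \<epsilon>: "\<epsilon> > 0" and \<eta>: "\<eta> > 8 * real CARD('d) * \<epsilon>" and w: "w \<in> scaleR \<epsilon> ` L \<rightarrow> {0, 1}"
  defines "P \<equiv> {(i, j). i \<in> L \<and> j \<in> L \<and> i - j \<in> half_open_cube (\<eta> / \<epsilon>)}"
    and "M \<equiv> unit_ball_vol CARD('d) * (\<epsilon> * CARD('d)) ^ CARD('d)"
  shows "(\<integral>\<^sup>+y\<in>cball 0 (\<eta> / 4). translation_gap (interpolation L \<epsilon> w) y \<partial>lborel)
    \<le> ennreal (M ^ 2) * (\<Sum>\<^sub>\<infinity>(i, j)\<in>P. ennreal \<bar>w (\<epsilon> *\<^sub>R i) - w (\<epsilon> *\<^sub>R j)\<bar>)"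
proof -
  define v where "v = interpolation L \<epsilon> w"
  have v_ind: "v = indicator {x. v x = 1}" and "{x. v x = 1} \<in> sets borel"
    unfolding v_def using interpolation_eq_indicator[OF \<epsilon> w] by blast+
  then have [measurable]: "v \<in> borel_measurable borel"
    by (metis borel_measurable_indicator)
  define V where "V i = scaleR \<epsilon> ` voronoi_cell L i" for i
  have V[measurable]: "V i \<in> sets borel" for i
    unfolding V_def by (rule sets_scaled_voronoi_cell[OF \<epsilon>])
  have M: "M \<ge> 0" using \<epsilon> by (simp add: M_def)
  have VM: "emeasure lborel (V i) \<le> ennreal M" if "i \<in> L" for i
    unfolding V_def M_def by (rule emeasure_scaled_voronoi_cell_le[OF \<epsilon> that])
  have P: "countable P"
    by (rule countable_subset[OF _ countable_SIGMA[OF lattice_countable lattice_countable]])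
      (auto simp: P_def)
  define a where "a p = (case p of (i, j) \<Rightarrow> ennreal \<bar>w (\<epsilon> *\<^sub>R i) - w (\<epsilon> *\<^sub>R j)\<bar>)" for p
  let ?c = "\<lambda>p x z. a p * (indicator (V (fst p)) x * indicator (V (snd p)) z) :: ennreal"
  let ?B = "cball (0::real^'d) (\<eta> / 4)"
  have pair: "(i, j) \<in> P" if i: "i \<in> L" "x \<in> V i" and j: "j \<in> L" "z \<in> V j" and xz: "norm (z - x) \<le> \<eta> / 4"
    for i j x z
  proof -
    have "norm (\<epsilon> *\<^sub>R i - x) \<le> \<epsilon> * CARD('d)" "norm (\<epsilon> *\<^sub>R j - z) \<le> \<epsilon> * CARD('d)"
      using subsetD[OF scaled_voronoi_cell_subset_cball[OF \<epsilon> i(1)], of x]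
        subsetD[OF scaled_voronoi_cell_subset_cball[OF \<epsilon> j(1)], of z] i(2) j(2)
      unfolding V_def mem_cball dist_norm by blast+
    moreover have "norm (\<epsilon> *\<^sub>R (i - j)) \<le> norm (\<epsilon> *\<^sub>R i - x) + norm (\<epsilon> *\<^sub>R j - z) + norm (z - x)"
    proof -
      have "\<epsilon> *\<^sub>R (i - j) = (\<epsilon> *\<^sub>R i - x) - (\<epsilon> *\<^sub>R j - z) - (z - x)"
        by (simp add: algebra_simps)
      then show ?thesis
        using norm_triangle_ineq4[of "(\<epsilon> *\<^sub>R i - x) - (\<epsilon> *\<^sub>R j - z)" "z - x"]
          norm_triangle_ineq4[of "\<epsilon> *\<^sub>R i - x" "\<epsilon> *\<^sub>R j - z"] by simp
    qed
    ultimately have "\<epsilon> * norm (i - j) < \<eta> / 2"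
      using xz \<eta> \<epsilon> by (simp add: mult.commute)
    then have "norm (i - j) < (\<eta> / \<epsilon>) / 2" using \<epsilon> by (simp add: field_simps)
    then have "\<bar>(i - j) $ k\<bar> < (\<eta> / \<epsilon>) / 2" for k
      using component_le_norm_cart[of "i - j" k] by linarith
    then have "- (\<eta> / \<epsilon>) / 2 \<le> (i - j) $ k \<and> (i - j) $ k < \<eta> / \<epsilon> / 2" for k
      unfolding abs_less_iff minus_divide_left[symmetric] by (meson less_imp_le minus_less_iff)
    then have "i - j \<in> half_open_cube (\<eta> / \<epsilon>)"
      unfolding half_open_cube_def by blast
    then show ?thesis using i(1) j(1) by (simp add: P_def)
  qed
  have good: "AE x in lborel. \<exists>i\<in>L. x \<in> V i"
    unfolding V_def by (rule AE_in_scaled_voronoi_cell[OF \<epsilon>])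
  have [measurable]: "?B \<in> sets borel" by simp
  have joint: "(\<lambda>(y, x). ennreal \<bar>v (x + y) - v x\<bar> * indicator ?B y) \<in> borel_measurable (lborel \<Otimes>\<^sub>M lborel)"
    by measurable
  have "(\<integral>\<^sup>+y\<in>?B. translation_gap v y \<partial>lborel)
      = (\<integral>\<^sup>+y. (\<integral>\<^sup>+x. ennreal \<bar>v (x + y) - v x\<bar> * indicator ?B y \<partial>lborel) \<partial>lborel)"
    unfolding translation_gap_def by (intro nn_integral_cong nn_integral_multc[symmetric]) measurable
  also have "\<dots> = (\<integral>\<^sup>+x. (\<integral>\<^sup>+y. ennreal \<bar>v (x + y) - v x\<bar> * indicator ?B y \<partial>lborel) \<partial>lborel)"
    by (rule lborel_pair.Fubini'[OF joint, symmetric])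
  also have "\<dots> = (\<integral>\<^sup>+x. (\<integral>\<^sup>+z. ennreal \<bar>v z - v x\<bar> * indicator ?B (z - x) \<partial>lborel) \<partial>lborel)"
  proof (rule nn_integral_cong)
    fix x
    have "(\<lambda>z. ennreal \<bar>v z - v x\<bar> * indicator ?B (z - x)) \<in> borel_measurable borel"
      by measurable
    from nn_integral_lborel_translate[OF this, of x]
    show "(\<integral>\<^sup>+y. ennreal \<bar>v (x + y) - v x\<bar> * indicator ?B y \<partial>lborel)
        = (\<integral>\<^sup>+z. ennreal \<bar>v z - v x\<bar> * indicator ?B (z - x) \<partial>lborel)"
      by (simp add: add.commute)
  qed
  also have "\<dots> \<le> (\<integral>\<^sup>+x. (\<integral>\<^sup>+z. (\<integral>\<^sup>+p. ?c p x z \<partial>count_space P) \<partial>lborel) \<partial>lborel)"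
  proof (rule nn_integral_mono_AE)
    show "AE x in lborel. (\<integral>\<^sup>+z. ennreal \<bar>v z - v x\<bar> * indicator ?B (z - x) \<partial>lborel)
        \<le> (\<integral>\<^sup>+z. (\<integral>\<^sup>+p. ?c p x z \<partial>count_space P) \<partial>lborel)"
      using good
    proof eventually_elim
      case (elim x)
      then obtain i where i: "i \<in> L" "x \<in> V i" by blast
      show ?case
      proof (rule nn_integral_mono_AE)
        show "AE z in lborel. ennreal \<bar>v z - v x\<bar> * indicator ?B (z - x) \<le> (\<integral>\<^sup>+p. ?c p x z \<partial>count_space P)"
          using good
        proof eventually_elim
          case (elim z)
          then obtain j where j: "j \<in> L" "z \<in> V j" by blast
          show ?case
          proof (cases "norm (z - x) \<le> \<eta> / 4")
            case True
            have "v x = w (\<epsilon> *\<^sub>R i)" "v z = w (\<epsilon> *\<^sub>R j)"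
              using interpolation_eq[OF \<epsilon>] i j unfolding v_def V_def by blast+
            then have "ennreal \<bar>v z - v x\<bar> * indicator ?B (z - x) = ?c (i, j) x z"
              using True i j by (simp add: a_def abs_minus_commute)
            also have "\<dots> \<le> (\<integral>\<^sup>+p. ?c p x z \<partial>count_space P)"
              by (rule nn_integral_ge_point[OF pair[OF i j True]])
            finally show ?thesis .
          qed simp
        qed
      qed
    qed
  qed
  also have "\<dots> = (\<integral>\<^sup>+x. (\<integral>\<^sup>+p. (\<integral>\<^sup>+z. ?c p x z \<partial>lborel) \<partial>count_space P) \<partial>lborel)"
    by (intro nn_integral_cong nn_integral_count_space_nn_integral P) measurable
  also have "\<dots> = (\<integral>\<^sup>+x. (\<integral>\<^sup>+p. a p * emeasure lborel (V (snd p)) * indicator (V (fst p)) x \<partial>count_space P) \<partial>lborel)"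
  proof (intro nn_integral_cong)
    fix x p
    have "(\<integral>\<^sup>+z. ?c p x z \<partial>lborel) = (\<integral>\<^sup>+z. (a p * indicator (V (fst p)) x) * indicator (V (snd p)) z \<partial>lborel)"
      by (simp add: mult.assoc)
    also have "\<dots> = (a p * indicator (V (fst p)) x) * emeasure lborel (V (snd p))"
      by (rule nn_integral_cmult_indicator) simp
    finally show "(\<integral>\<^sup>+z. ?c p x z \<partial>lborel) = a p * emeasure lborel (V (snd p)) * indicator (V (fst p)) x"
      by (simp only: mult_ac)
  qed
  also have "\<dots> = (\<integral>\<^sup>+p. (\<integral>\<^sup>+x. a p * emeasure lborel (V (snd p)) * indicator (V (fst p)) x \<partial>lborel) \<partial>count_space P)"
    by (rule nn_integral_count_space_nn_integral[OF P]) measurable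
  also have "\<dots> = (\<integral>\<^sup>+p. a p * emeasure lborel (V (snd p)) * emeasure lborel (V (fst p)) \<partial>count_space P)"
    by (intro nn_integral_cong nn_integral_cmult_indicator) simp
  also have "\<dots> \<le> (\<integral>\<^sup>+p. ennreal (M ^ 2) * a p \<partial>count_space P)"
  proof (rule nn_integral_mono)
    fix p assume "p \<in> space (count_space P)"
    then have "fst p \<in> L" "snd p \<in> L" by (auto simp: P_def)
    then have "a p * (emeasure lborel (V (snd p)) * emeasure lborel (V (fst p))) \<le> a p * (ennreal M * ennreal M)"
      by (intro mult_left_mono mult_mono VM) auto
    also have "\<dots> = ennreal (M ^ 2) * a p"
      using M by (simp add: power2_eq_square ennreal_mult mult.commute)
    finally show "a p * emeasure lborel (V (snd p)) * emeasure lborel (V (fst p)) \<le> ennreal (M ^ 2) * a p"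
      by (simp only: mult.assoc)
  qed
  also have "\<dots> = ennreal (M ^ 2) * (\<integral>\<^sup>+p. a p \<partial>count_space P)"
    by (rule nn_integral_cmult) simp
  also have "\<dots> \<le> ennreal (M ^ 2) * infsum a P"
    by (intro mult_left_mono nn_integral_count_space_le_infsum P) simp
  finally show ?thesis unfolding v_def a_def[abs_def] .
qed

text \<open>The volume bound for pairs of cells has the factor \<open>\<epsilon>\<close> to the power \<open>2 d\<close>, and the averaging over a
  ball of radius \<open>\<eta> \<epsilon> / 8\<close> costs \<open>(\<eta> \<epsilon>)\<close> to the power \<open>- d\<close>, so the normalisation of the energy leaves
  exactly one power of \<open>\<eta> \<epsilon>\<close>.\<close>

lemma translation_gap_interpolation_le:
  assumes \<epsilon>: "\<epsilon> > 0" and \<eta>: "\<eta> \<epsilon> > 8 * real CARD('d) * \<epsilon>"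
    and w: "w \<in> scaleR \<epsilon> ` L \<rightarrow> {0, 1}"
    and C: "C \<ge> 0" "energy L \<eta> \<epsilon> w \<le> ennreal C"
  defines "d \<equiv> CARD('d)"
  shows "translation_gap (interpolation L \<epsilon> w) h
    \<le> ennreal (16 * 8 ^ d * unit_ball_vol d * real d ^ (2 * d) * C * (norm h + \<eta> \<epsilon> / 8))"
proof -
  let ?T = "translation_gap (interpolation L \<epsilon> w)"
  define \<omega> where "\<omega> = unit_ball_vol (real d)"
  define t where "t = \<eta> \<epsilon>"
  define S where "S = (\<Sum>\<^sub>\<infinity>(i, j) \<in> {(i, j). i \<in> L \<and> j \<in> L \<and> i - j \<in> half_open_cube (t / \<epsilon>)}.
      ennreal \<bar>w (\<epsilon> *\<^sub>R i) - w (\<epsilon> *\<^sub>R j)\<bar>)"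
  have "8 * real d * \<epsilon> \<ge> 0" using \<epsilon> by simp
  then have t: "t > 0" using \<eta> unfolding t_def d_def by linarith
  have \<omega>: "\<omega> > 0" by (simp add: \<omega>_def)
  define A where "A = (\<omega> * real d ^ d)\<^sup>2"
  have A: "A \<ge> 0" by (simp add: A_def)
  have E: "ennreal (\<epsilon> ^ (2 * d) / t ^ (d + 1)) * S \<le> ennreal C"
    using C(2) unfolding energy_def S_def t_def d_def .
  have "ennreal (\<epsilon> ^ (2 * d)) * S = ennreal (t ^ (d + 1)) * (ennreal (\<epsilon> ^ (2 * d) / t ^ (d + 1)) * S)"
  proof -
    have "ennreal (\<epsilon> ^ (2 * d)) = ennreal (t ^ (d + 1)) * ennreal (\<epsilon> ^ (2 * d) / t ^ (d + 1))"
      using t \<epsilon> by (subst ennreal_mult[symmetric]) auto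
    then show ?thesis by (simp only: mult.assoc)
  qed
  also have "\<dots> \<le> ennreal (t ^ (d + 1)) * ennreal C"
    by (rule mult_left_mono[OF E]) simp
  finally have S: "ennreal (\<epsilon> ^ (2 * d)) * S \<le> ennreal (t ^ (d + 1) * C)"
    using t C(1) by (simp add: ennreal_mult)
  have "(\<integral>\<^sup>+y\<in>cball 0 (t / 4). ?T y \<partial>lborel) \<le> ennreal ((\<omega> * (\<epsilon> * real d) ^ d)\<^sup>2) * S"
    using gap_integral_le_interaction_sum[OF \<epsilon> \<eta> w] unfolding \<omega>_def d_def t_def S_def .
  also have "(\<omega> * (\<epsilon> * real d) ^ d)\<^sup>2 = A * \<epsilon> ^ (2 * d)"
    by (simp add: A_def power_mult_distrib power_mult[symmetric] mult_ac)
  also have "ennreal (A * \<epsilon> ^ (2 * d)) * S = ennreal A * (ennreal (\<epsilon> ^ (2 * d)) * S)"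
    using A \<epsilon> by (simp add: ennreal_mult mult.assoc)
  also have "\<dots> \<le> ennreal A * ennreal (t ^ (d + 1) * C)"
    by (rule mult_left_mono[OF S]) simp
  finally have mean: "(\<integral>\<^sup>+y\<in>cball 0 (t / 4). ?T y \<partial>lborel) \<le> ennreal (A * (t ^ (d + 1) * C))"
    using A t C(1) by (simp add: ennreal_mult)
  have meas: "interpolation L \<epsilon> w \<in> borel_measurable borel"
    by (subst interpolation_eq_indicator(1)[OF \<epsilon> w])
      (intro borel_measurable_indicator interpolation_eq_indicator(2)[OF \<epsilon> w])
  define K where "K = 16 * 8 ^ d * \<omega> * real d ^ (2 * d) * C"
  have K: "K \<ge> 0" using \<omega> C(1) by (simp add: K_def)
  have small: "?T h \<le> ennreal (K * (t / 8))" if h: "norm h \<le> t / 8" for h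
  proof -
    have pos: "\<omega> * (t / 8) ^ d > 0" using \<omega> t by simp
    have "ennreal (\<omega> * (t / 8) ^ d) * ?T h \<le> 2 * (\<integral>\<^sup>+y\<in>cball 0 (2 * (t / 8)). ?T y \<partial>lborel)"
      using translation_gap_le_mean[OF meas h] t
      by (simp add: emeasure_cball \<omega>_def d_def)
    also have "\<dots> \<le> 2 * ennreal (A * (t ^ (d + 1) * C))"
      using mean by (intro mult_left_mono) simp_all
    also have "\<dots> = ennreal (2 * (A * (t ^ (d + 1) * C)))"
      using A t C(1) by (simp add: ennreal_mult)
    also have "2 * (A * (t ^ (d + 1) * C)) = (\<omega> * (t / 8) ^ d) * (K * (t / 8))"
    proof -
      have "real d ^ (2 * d) = (real d ^ d)\<^sup>2" by (simp add: power_mult[symmetric] mult.commute)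
      then show ?thesis
        by (simp add: A_def K_def power_divide power_mult_distrib power2_eq_square)
    qed
    also have "ennreal \<dots> = ennreal (\<omega> * (t / 8) ^ d) * ennreal (K * (t / 8))"
      using pos K t by (intro ennreal_mult) auto
    finally have le: "ennreal (\<omega> * (t / 8) ^ d) * ?T h \<le> ennreal (\<omega> * (t / 8) ^ d) * ennreal (K * (t / 8))" .
    have "ennreal (\<omega> * (t / 8) ^ d) \<noteq> 0" using pos by (simp only: ennreal_eq_0_iff not_le)
    then show ?thesis
      using le by (subst (asm) ennreal_mult_le_mult_iff) (simp_all only: ennreal_neq_top not_False_eq_True)
  qed
  have "?T h \<le> ennreal (K * (norm h + t / 8))"
    by (rule translation_gap_linear[OF meas _ K small]) (use t in auto)
  then show ?thesis unfolding K_def \<omega>_def t_def .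
qed

end

section \<open>Convergence of the interpolations\<close>

lemma L1_loc_indicator:
  assumes [measurable]: "B \<in> sets borel"
  shows "L1_loc (indicator B :: 'a::euclidean_space \<Rightarrow> real)"
  unfolding L1_loc_def
proof (intro allI impI)
  fix K :: "'a set" assume K: "compact K"
  then have [measurable]: "K \<in> sets borel" by (simp add: borel_compact)
  have "emeasure lborel (B \<inter> K) \<le> emeasure lborel K" by (rule emeasure_mono) auto
  also have "\<dots> < \<infinity>" by (rule emeasure_bounded_finite[OF compact_imp_bounded[OF K]])
  finally have "integrable lborel (indicator (B \<inter> K) :: 'a \<Rightarrow> real)"
    by (intro integrable_real_indicator) auto
  then have "integrable lebesgue (indicator (B \<inter> K) :: 'a \<Rightarrow> real)"
    by (simp add: integrable_completion)
  moreover have "(\<lambda>x. indicator K x *\<^sub>R indicator B x) = (indicator (B \<inter> K) :: 'a \<Rightarrow> real)"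
    by (auto simp: indicator_def)
  ultimately show "set_integrable lebesgue K (indicator B :: 'a \<Rightarrow> real)"
    unfolding set_integrable_def by simp
qed

lemma converges_L1_loc_indicator:
  fixes E :: "nat \<Rightarrow> 'a::euclidean_space set"
  assumes [measurable]: "\<And>n. E n \<in> sets borel" "A \<in> sets borel"
    and lim: "AE x in lborel. \<forall>\<^sub>F n in sequentially. x \<in> E n \<longleftrightarrow> x \<in> A"
  shows "converges_L1_loc (\<lambda>n. indicator (E n)) (indicator A)"
  unfolding converges_L1_loc_def
proof (intro conjI allI impI L1_loc_indicator assms)
  fix K :: "'a set" assume K: "compact K"
  then have [measurable]: "K \<in> sets borel" by (simp add: borel_compact)
  let ?f = "\<lambda>n x. indicator K x *\<^sub>R \<bar>indicator (E n) x - indicator A x :: real\<bar>"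
  have "(\<lambda>n. LINT x|lborel. ?f n x) \<longlonglongrightarrow> (LINT x|(lborel :: 'a measure). (0::real))"
  proof (rule integral_dominated_convergence[where w = "indicator K"])
    have "emeasure lborel K < \<infinity>" by (rule emeasure_bounded_finite[OF compact_imp_bounded[OF K]])
    then show "integrable lborel (indicator K :: 'a \<Rightarrow> real)" by (intro integrable_real_indicator) auto
    show "AE x in lborel. (\<lambda>n. ?f n x) \<longlonglongrightarrow> 0"
      using lim
    proof eventually_elim
      case (elim x)
      then have "\<forall>\<^sub>F n in sequentially. ?f n x = 0"
        by eventually_elim (simp add: indicator_def)
      then show ?case by (rule tendsto_eventually)
    qed
    show "AE x in lborel. norm (?f n x) \<le> indicator K x" for n
      by (intro always_eventually allI) (auto simp: indicator_def)
  qed measurable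
  moreover have "(LINT x:K|lebesgue. \<bar>indicator (E n) x - indicator A x :: real\<bar>) = (LINT x|lborel. ?f n x)" for n
    unfolding set_lebesgue_integral_def by (rule integral_completion) measurable
  ultimately show "(\<lambda>n. LINT x:K|lebesgue. \<bar>indicator (E n) x - indicator A x :: real\<bar>) \<longlonglongrightarrow> 0"
    by simp
qed

theorem lemma1:
  fixes L :: "(real^'d) set"
    and \<eta> :: "real \<Rightarrow> real"
    and u :: "real \<Rightarrow> real^'d \<Rightarrow> real"
  assumes "L \<noteq> {}" and "locally_finite L" and "unit_periodic L"
    and "\<And>\<epsilon>. \<epsilon> > 0 \<Longrightarrow> \<eta> \<epsilon> > 0"
    and "(\<eta> \<longlongrightarrow> 0) (at_right 0)"
    and "((\<lambda>\<epsilon>. \<epsilon> / \<eta> \<epsilon>) \<longlongrightarrow> 0) (at_right 0)"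
    and "\<And>\<epsilon>. \<epsilon> > 0 \<Longrightarrow> u \<epsilon> \<in> scaleR \<epsilon> ` L \<rightarrow> {0, 1}"
    and "(SUP \<epsilon>\<in>{0<..}. energy L \<eta> \<epsilon> (u \<epsilon>)) < \<infinity>"
  shows "\<forall>s :: nat \<Rightarrow> real. (\<forall>n. s n > 0) \<and> s \<longlonglongrightarrow> 0 \<longrightarrow>
           (\<exists>r A. strict_mono r \<and> finite_perimeter A \<and>
              converges_L1_loc (\<lambda>n. interpolation L (s (r n)) (u (s (r n)))) (indicator A))"
proof (intro allI impI)
  fix s :: "nat \<Rightarrow> real"
  assume s: "(\<forall>n. s n > 0) \<and> s \<longlonglongrightarrow> 0"
  then have spos: "s n > 0" for n by blast
  obtain C where C: "C \<ge> 0" "(SUP \<epsilon>\<in>{0<..}. energy L \<eta> \<epsilon> (u \<epsilon>)) = ennreal C"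
    using assms(8) by (cases "SUP \<epsilon>\<in>{0<..}. energy L \<eta> \<epsilon> (u \<epsilon>)") auto
  have energy: "energy L \<eta> \<epsilon> (u \<epsilon>) \<le> ennreal C" if "\<epsilon> > 0" for \<epsilon>
    unfolding C(2)[symmetric] using that by (intro SUP_upper) simp
  have "s n \<noteq> 0" for n using spos[of n] by simp
  then have s0: "filterlim s (at_right 0) sequentially"
    using s by (simp add: filterlim_at)
  have \<eta>s: "(\<lambda>n. \<eta> (s n)) \<longlonglongrightarrow> 0"
    by (rule filterlim_compose[OF assms(5) s0])
  have "(\<lambda>n. s n / \<eta> (s n)) \<longlonglongrightarrow> 0"
    by (rule filterlim_compose[OF assms(6) s0])
  then have "\<forall>\<^sub>F n in sequentially. s n / \<eta> (s n) < 1 / (8 * real CARD('d))"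
    by (rule order_tendstoD) simp
  then obtain N where N: "\<And>n. n \<ge> N \<Longrightarrow> s n / \<eta> (s n) < 1 / (8 * real CARD('d))"
    by (auto simp: eventually_sequentially)
  \<comment> \<open>The estimate on translations needs \<open>\<epsilon> / \<eta> \<epsilon>\<close> to be small, so finitely many terms are dropped.\<close>
  define t where "t n = s (n + N)" for n
  have t: "t n > 0" for n by (simp add: t_def spos)
  have wide: "\<eta> (t n) > 8 * real CARD('d) * t n" for n
    using N[of "n + N"] assms(4)[OF t[of n]] by (simp add: t_def field_simps)
  define E where "E n = {x. interpolation L (t n) (u (t n)) x = 1}" for n
  have E: "interpolation L (t n) (u (t n)) = indicator (E n)" "E n \<in> sets borel" for n
    unfolding E_def by (rule interpolation_eq_indicator[OF assms(1-3) t assms(7)[OF t]])+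
  define K where
    "K = 16 * 8 ^ CARD('d) * unit_ball_vol CARD('d) * real CARD('d) ^ (2 * CARD('d)) * C"
  have K: "K \<ge> 0" using C(1) by (simp add: K_def)
  have gap: "translation_gap (indicator (E n)) h \<le> ennreal (K * (norm h + \<eta> (t n) / 8))" for n h
    using translation_gap_interpolation_le[where \<eta> = \<eta>, OF assms(1-3) t wide assms(7)[OF t] C(1) energy[OF t]]
    unfolding K_def E(1) .
  have "(\<lambda>n. \<eta> (t n)) \<longlonglongrightarrow> 0"
    unfolding t_def by (rule LIMSEQ_ignore_initial_segment[OF \<eta>s])
  then have e: "(\<lambda>n. \<eta> (t n) / 8) \<longlonglongrightarrow> 0"
    by (rule tendsto_divide_zero)
  have e0: "\<eta> (t n) / 8 \<ge> 0" for n using assms(4)[OF t[of n]] by simp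
  obtain r A where r: "strict_mono (r :: nat \<Rightarrow> nat)" and A: "A \<in> sets borel"
    and lim: "AE x in lborel. \<forall>\<^sub>F n in sequentially. x \<in> E (r n) \<longleftrightarrow> x \<in> A"
    and gapA: "\<And>h. translation_gap (indicator A) h \<le> ennreal (K * norm h)"
    using translation_gap_compact[OF E(2) K e0 e gap] by blast
  have "strict_mono (\<lambda>n. r n + N)" using r by (simp add: strict_mono_def)
  moreover have "finite_perimeter A"
    by (rule finite_perimeter_if_translation_gap_linear[OF A K gapA])
  moreover have "converges_L1_loc (\<lambda>n. interpolation L (s (r n + N)) (u (s (r n + N)))) (indicator A)"
    using converges_L1_loc_indicator[OF E(2) A lim] unfolding E(1)[symmetric] t_def .
  ultimately show "\<exists>r A. strict_mono r \<and> finite_perimeter A \<and>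
      converges_L1_loc (\<lambda>n. interpolation L (s (r n)) (u (s (r n)))) (indicator A)"
    by (intro exI[of _ "\<lambda>n. r n + N"] exI[of _ A]) simp
qed

end
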